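(* Let $n\ge 1$ and let $K_n$ be the (invertible, skew-symmetric) Kasteleyn matrix of the graph $G_n$, with $\mathbf{b}=(2n,2n+1-[n]_2)$. Let $0\le i_1\le 2n-1$. (1) If $(x_1,x_2)=(i_1,i_1+2i_2+1)$ with $0\le i_2\le n-\lceil i_1/2\rceil$, then $$K_n^{-1}((x_1,x_2),\mathbf{b})=\sum_{l=0}^{i_1}(-1)^{i_2+l}\binom{i_2-1+l}{l}\,h_n^{1,\mathbf{b}}(i_1-l).$$ (2) If $(x_1,x_2)=(i_1,i_1+2i_2)$ with $0\le i_2\le n-\lfloor i_1/2\rfloor$, then $$K_n^{-1}((x_1,x_2),\mathbf{b})=\sum_{l=0}^{i_2}(-1)^{i_2}\binom{i_2}{l}\,h_n^{0,\mathbf{b}}(i_1+l).$$ (3) When $n$ is even, $K_n^{-1}((2n,2n),\mathbf{b})=-1$.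
   Context: Notation: $[x]_2\in\{0,1\}$ is $x \bmod 2$; $\mathbbm{1}$ denotes an indicator; $\mathrm{i}=\sqrt{-1}$. Binomials: $\binom{a}{l}=a(a-1)\cdots(a-l+1)/l!$ for integers $a$ and $l\ge 0$ (so $\binom{-1}{0}=1$, $\binom{l-1}{l}=0$ for $l\ge1$), and $\binom{a}{-1}=0$. Graph: $G_n=(\mathtt V_n,\mathtt E_n)$, where $\mathtt V_n=\{(x_1,x_2)\in\mathbb Z^2: 0\le x_1\le 2n,\ x_1\le x_2\le 2n+1\}$, with the vertex $(2n,2n+1)$ removed when $n$ is odd, and $\mathtt E_n$ consists of - the edges $\{(x_1,x_2),(x_1+1,x_2)\}$ with $0\le x_1\le 2n-1$, $x_1\le x_2\le 2n+1$, $[x_1+x_2]_2=1$; - the edges $\{(x_1,x_2),(x_1,x_2+1)\}$ with $0\le x_1\le 2n-[n]_2$, $x_1\le x_2\le 2n$; - the edges $\{(x_1,x_1),(x_1+1,x_1+1)\}$ with $0\le x_1\le 2n-1$. Kasteleyn matrix: $K_n=(K_n(x,y))_{x,y\in\mathtt V_n}$ with $K_n(x,y)=k_n(x,y)-k_n(y,x)$, where $k_n((x_1,x_2),(y_1,y_2))=1$ if [$[x_1+x_2]_2=0$, $x_2=y_2$, $x_1-y_1=1$], or [$[x_1+x_2]_2=0$, $|y_2-x_2|=1$, $x_1=y_1$], or [$x_1=x_2$ and $y_1=y_2=x_1-1$], and $k_n=0$ otherwise. $|\mathrm{Pf}\,K_n|$ is the number of perfect matchings of $G_n$, which is nonzero.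 With $C_m=\frac1{m+1}\binom{2m}{m}$ the Catalan numbers, set $$p(n,k,\ell)=\frac{(n+k-2\ell+1)!\,(2n-k-\ell+1)!}{(k-\ell)!\,(3n-k+2-2\ell)!}(-1)^k(3n-3k+2)\,C_{n-k}.$$ Let $\Gamma_0$ be a positively oriented circle around the origin of radius less than $1$. For $0\le i\le 2n$, $$h_n^{0,\mathbf b}(i)=-[i+1]_2+\sum_{k=0}^n p(n,k,0)\frac1{2\pi \mathrm i}\int_{\Gamma_0}\mathrm dr\,\frac{(1+r)^{n-k}}{(1-r)\,r^{i-2k}},$$ $$h_n^{1,\mathbf b}(i)=\sum_{k=0}^n p(n,k,0)\frac1{2\pi \mathrm i}\int_{\Gamma_0}\mathrm dr\,\frac{(1+r)^{n-k}}{r^{i-2k+1}}.$$ *)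

theory Defs
  imports "HOL-Complex_Analysis.Complex_Analysis"
begin

type_synonym vertex = "int \<times> int"

definition graph_V :: "nat \<Rightarrow> vertex set" where
  "graph_V n = {(x1, x2). 0 \<le> x1 \<and> x1 \<le> 2 * int n \<and> x1 \<le> x2 \<and> x2 \<le> 2 * int n + 1}
     - (if odd n then {(2 * int n, 2 * int n + 1)} else {})"

definition graph_E :: "nat \<Rightarrow> vertex set set" where
  "graph_E n =
     {{(x1, x2), (x1 + 1, x2)} | x1 x2.
        0 \<le> x1 \<and> x1 \<le> 2 * int n - 1 \<and> x1 \<le> x2 \<and> x2 \<le> 2 * int n + 1 \<and> (x1 + x2) mod 2 = 1}
   \<union> {{(x1, x2), (x1, x2 + 1)} | x1 x2.
        0 \<le> x1 \<and> x1 \<le> 2 * int n - int n mod 2 \<and> x1 \<le> x2 \<and> x2 \<le> 2 * int n}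
   \<union> {{(x1, x1), (x1 + 1, x1 + 1)} | x1. 0 \<le> x1 \<and> x1 \<le> 2 * int n - 1}"

fun kast_half :: "vertex \<Rightarrow> vertex \<Rightarrow> complex" where
  "kast_half (x1, x2) (y1, y2) =
     (if ((x1 + x2) mod 2 = 0 \<and> x2 = y2 \<and> x1 - y1 = 1)
       \<or> ((x1 + x2) mod 2 = 0 \<and> \<bar>y2 - x2\<bar> = 1 \<and> x1 = y1)
       \<or> (x1 = x2 \<and> y1 = x1 - 1 \<and> y2 = x1 - 1)
      then 1 else 0)"

(* The formula for the entries does not involve n: the matrix K_n is the
   restriction of kasteleyn to graph_V n. *)
definition kasteleyn :: "vertex \<Rightarrow> vertex \<Rightarrow> complex" where
  "kasteleyn x y = kast_half x y - kast_half y x"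

lemma kasteleyn_skew: "kasteleyn y x = - kasteleyn x y"
  by (simp add: kasteleyn_def)

lemma finite_graph_V: "finite (graph_V n)"
proof -
  have "graph_V n \<subseteq> {0..2 * int n} \<times> {0..2 * int n + 1}"
    by (auto simp: graph_V_def)
  then show ?thesis
    by (rule finite_subset) simp
qed

lemma kasteleyn_edge_arith:
  fixes a b c d N :: int
  assumes V: "0 \<le> a" "a \<le> 2 * N" "a \<le> b" "b \<le> 2 * N + 1"
     "0 \<le> c" "c \<le> 2 * N" "c \<le> d" "d \<le> 2 * N + 1"
     "N mod 2 = 1 \<Longrightarrow> a = 2 * N \<Longrightarrow> b \<noteq> 2 * N + 1"
     "N mod 2 = 1 \<Longrightarrow> c = 2 * N \<Longrightarrow> d \<noteq> 2 * N + 1"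
  shows "((((a + b) mod 2 = 0 \<and> b = d \<and> a - c = 1) \<or> ((a + b) mod 2 = 0 \<and> \<bar>d - b\<bar> = 1 \<and> a = c)
       \<or> (a = b \<and> c = a - 1 \<and> d = a - 1)) \<noteq>
      (((c + d) mod 2 = 0 \<and> d = b \<and> c - a = 1) \<or> ((c + d) mod 2 = 0 \<and> \<bar>b - d\<bar> = 1 \<and> c = a)
       \<or> (c = d \<and> a = c - 1 \<and> b = c - 1))) \<longleftrightarrow>
      (d = b \<and> (a + b) mod 2 = 1 \<and> c = a + 1 \<and> 0 \<le> a \<and> a \<le> 2 * N - 1 \<and> a \<le> b \<and> b \<le> 2 * N + 1)
    \<or> (d = b \<and> (c + d) mod 2 = 1 \<and> a = c + 1 \<and> 0 \<le> c \<and> c \<le> 2 * N - 1 \<and> c \<le> d \<and> d \<le> 2 * N + 1)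
    \<or> (a = c \<and> d = b + 1 \<and> 0 \<le> a \<and> a \<le> 2 * N - N mod 2 \<and> a \<le> b \<and> b \<le> 2 * N)
    \<or> (a = c \<and> b = d + 1 \<and> 0 \<le> c \<and> c \<le> 2 * N - N mod 2 \<and> c \<le> d \<and> d \<le> 2 * N)
    \<or> (a = b \<and> c = a + 1 \<and> d = a + 1 \<and> 0 \<le> a \<and> a \<le> 2 * N - 1)
    \<or> (c = d \<and> a = c + 1 \<and> b = c + 1 \<and> 0 \<le> c \<and> c \<le> 2 * N - 1)"
proof -
  have m: "(a + b) mod 2 = 0 \<or> (a + b) mod 2 = 1" "N mod 2 = 0 \<or> N mod 2 = 1"
    by presburger+
  consider (1) "b = d" "c = a + 1" | (2) "b = d" "a = c + 1" | (3) "a = c" "d = b + 1" | (4) "a = c" "b = d + 1"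
    | (5) "c = a + 1" "d = b + 1" | (6) "a = c + 1" "b = d + 1"
    | (7) "\<not> (b = d \<and> c = a + 1)" "\<not> (b = d \<and> a = c + 1)" "\<not> (a = c \<and> d = b + 1)"
       "\<not> (a = c \<and> b = d + 1)" "\<not> (c = a + 1 \<and> d = b + 1)" "\<not> (a = c + 1 \<and> b = d + 1)"
    by blast
  then show ?thesis
  proof cases
    case 1
    have p: "((c + d) mod 2 = 0) = ((a + b) mod 2 \<noteq> 0)" "(a + b) mod 2 = 1 \<longleftrightarrow> (a + b) mod 2 \<noteq> 0"
      using 1 by presburger+
    show ?thesis unfolding p using 1 V(1-8) by simp
  next
    case 2
    have p: "((a + b) mod 2 = 0) = ((c + d) mod 2 \<noteq> 0)" "(c + d) mod 2 = 1 \<longleftrightarrow> (c + d) mod 2 \<noteq> 0"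
      using 2 by presburger+
    show ?thesis unfolding p using 2 V(1-8) by simp
  next
    case 3
    have p: "((c + d) mod 2 = 0) = ((a + b) mod 2 \<noteq> 0)" using 3 by presburger
    have q1: "b \<le> 2 * N" using 3 V(1-8) by linarith
    have q2: "a \<le> 2 * N - N mod 2"
    proof (cases "a = 2 * N")
      case True
      then have "c = 2 * N" "d = 2 * N + 1" using 3 V(1-8) by linarith+
      then have "N mod 2 = 0" using V(10) m(2) by blast
      then show ?thesis using V(1-8) 3 by simp
    next
      case False
      then show ?thesis using V(2) V(6) m(2) by linarith
    qed
    show ?thesis unfolding p using 3 q1 q2 V(1-8) by simp
  next
    case 4
    have p: "((c + d) mod 2 = 0) = ((a + b) mod 2 \<noteq> 0)" using 4 by presburger
    have q1: "d \<le> 2 * N" using 4 V(1-8) by linarith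
    have q2: "c \<le> 2 * N - N mod 2"
    proof (cases "c = 2 * N")
      case True
      then have "a = 2 * N" "b = 2 * N + 1" using 4 V(1-8) by linarith+
      then have "N mod 2 = 0" using V(9) m(2) by blast
      then show ?thesis using V(1-8) 4 by simp
    next
      case False
      then show ?thesis using V(2) V(6) m(2) by linarith
    qed
    show ?thesis unfolding p using 4 q1 q2 V(1-8) by simp
  next
    case 5 then show ?thesis using V(1-8) by auto
  next
    case 6 then show ?thesis using V(1-8) by auto
  next
    case 7
    have e: "a - c = 1 \<longleftrightarrow> a = c + 1" "c - a = 1 \<longleftrightarrow> c = a + 1" "\<bar>d - b\<bar> = 1 \<longleftrightarrow> d = b + 1 \<or> b = d + 1"
      "\<bar>b - d\<bar> = 1 \<longleftrightarrow> d = b + 1 \<or> b = d + 1"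
      by arith+
    have f: "\<not> (a = b \<and> c = a - 1 \<and> d = a - 1)" "\<not> (c = d \<and> a = c - 1 \<and> b = c - 1)"
      "\<not> (a = b \<and> c = a + 1 \<and> d = a + 1 \<and> X)" "\<not> (c = d \<and> a = c + 1 \<and> b = c + 1 \<and> X)" for X
      using 7(5,6) by auto
    have g: "\<not> (X \<and> b = d \<and> a = c + 1)" "\<not> (X \<and> d = b \<and> c = a + 1)"
      "\<not> (X \<and> (d = b + 1 \<or> b = d + 1) \<and> a = c)" "\<not> (X \<and> (d = b + 1 \<or> b = d + 1) \<and> c = a)"
      "\<not> (d = b \<and> X \<and> c = a + 1 \<and> Y)" "\<not> (d = b \<and> X \<and> a = c + 1 \<and> Y)"
      "\<not> (a = c \<and> d = b + 1 \<and> Y)" "\<not> (a = c \<and> b = d + 1 \<and> Y)" for X Y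
      using 7(1-4) by auto
    show ?thesis unfolding e by (simp only: f g simp_thms)
  qed
qed

lemma kasteleyn_nonzero_iff_edge:
  assumes "x \<in> graph_V n" and "y \<in> graph_V n"
  shows "kasteleyn x y \<noteq> 0 \<longleftrightarrow> {x, y} \<in> graph_E n"
proof -
  obtain a b c d where xy: "x = (a, b)" "y = (c, d)"
    by (cases x, cases y)
  have half_values: "kast_half u v = 0 \<or> kast_half u v = 1" for u v
    by (cases u; cases v) simp
  have half: "kasteleyn x y \<noteq> 0 \<longleftrightarrow> (kast_half x y = 1) \<noteq> (kast_half y x = 1)"
    using half_values[of x y] half_values[of y x] by (auto simp: kasteleyn_def)
  have parity: "int n mod 2 = 1 \<longleftrightarrow> odd n"
    by presburger
  have V: "0 \<le> a" "a \<le> 2 * int n" "a \<le> b" "b \<le> 2 * int n + 1"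
     "0 \<le> c" "c \<le> 2 * int n" "c \<le> d" "d \<le> 2 * int n + 1"
     "int n mod 2 = 1 \<Longrightarrow> a = 2 * int n \<Longrightarrow> b \<noteq> 2 * int n + 1"
     "int n mod 2 = 1 \<Longrightarrow> c = 2 * int n \<Longrightarrow> d \<noteq> 2 * int n + 1"
    using assms unfolding graph_V_def xy parity by auto
  have E: "{x, y} \<in> graph_E n \<longleftrightarrow>
      (d = b \<and> (a + b) mod 2 = 1 \<and> c = a + 1 \<and> 0 \<le> a \<and> a \<le> 2 * int n - 1 \<and> a \<le> b \<and> b \<le> 2 * int n + 1)
    \<or> (d = b \<and> (c + d) mod 2 = 1 \<and> a = c + 1 \<and> 0 \<le> c \<and> c \<le> 2 * int n - 1 \<and> c \<le> d \<and> d \<le> 2 * int n + 1)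
    \<or> (a = c \<and> d = b + 1 \<and> 0 \<le> a \<and> a \<le> 2 * int n - int n mod 2 \<and> a \<le> b \<and> b \<le> 2 * int n)
    \<or> (a = c \<and> b = d + 1 \<and> 0 \<le> c \<and> c \<le> 2 * int n - int n mod 2 \<and> c \<le> d \<and> d \<le> 2 * int n)
    \<or> (a = b \<and> c = a + 1 \<and> d = a + 1 \<and> 0 \<le> a \<and> a \<le> 2 * int n - 1)
    \<or> (c = d \<and> a = c + 1 \<and> b = c + 1 \<and> 0 \<le> c \<and> c \<le> 2 * int n - 1)"
  proof -
    have e1: "(\<exists>u v. {x, y} = {(u, v), (u + 1, v)} \<and> P u v) \<longleftrightarrow>
        (d = b \<and> c = a + 1 \<and> P a b) \<or> (d = b \<and> a = c + 1 \<and> P c d)" for P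
      unfolding xy doubleton_eq_iff prod.inject by blast
    have e2: "(\<exists>u v. {x, y} = {(u, v), (u, v + 1)} \<and> P u v) \<longleftrightarrow>
        (a = c \<and> d = b + 1 \<and> P a b) \<or> (a = c \<and> b = d + 1 \<and> P c d)" for P
      unfolding xy doubleton_eq_iff prod.inject by blast
    have e3: "(\<exists>u. {x, y} = {(u, u), (u + 1, u + 1)} \<and> P u) \<longleftrightarrow>
        (a = b \<and> c = a + 1 \<and> d = a + 1 \<and> P a) \<or> (c = d \<and> a = c + 1 \<and> b = c + 1 \<and> P c)" for P
      unfolding xy doubleton_eq_iff prod.inject by blast
    show ?thesis
      unfolding graph_E_def Un_iff mem_Collect_eq e1 e2 e3 by argo
  qed
  have h1: "kast_half x y = 1 \<longleftrightarrow>
      ((a + b) mod 2 = 0 \<and> b = d \<and> a - c = 1) \<or> ((a + b) mod 2 = 0 \<and> \<bar>d - b\<bar> = 1 \<and> a = c)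
       \<or> (a = b \<and> c = a - 1 \<and> d = a - 1)"
    unfolding xy kast_half.simps by simp
  have h2: "kast_half y x = 1 \<longleftrightarrow>
      ((c + d) mod 2 = 0 \<and> d = b \<and> c - a = 1) \<or> ((c + d) mod 2 = 0 \<and> \<bar>b - d\<bar> = 1 \<and> c = a)
       \<or> (c = d \<and> a = c - 1 \<and> b = c - 1)"
    unfolding xy kast_half.simps by simp
  show ?thesis
    unfolding half E h1 h2 by (rule kasteleyn_edge_arith[OF V])
qed

definition inverse_matrix_on ::
  "'v set \<Rightarrow> ('v \<Rightarrow> 'v \<Rightarrow> complex) \<Rightarrow> ('v \<Rightarrow> 'v \<Rightarrow> complex) \<Rightarrow> bool" where
  "inverse_matrix_on V A B \<longleftrightarrow>
     (\<forall>x\<in>V. \<forall>y\<in>V. (\<Sum>z\<in>V. A x z * B z y) = (if x = y then 1 else 0)) \<and>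
     (\<forall>x\<in>V. \<forall>y\<in>V. (\<Sum>z\<in>V. B x z * A z y) = (if x = y then 1 else 0))"

definition catalan :: "nat \<Rightarrow> real" where
  "catalan m = 1 / (real m + 1) * real ((2 * m) choose m)"

(* The factorial arguments are nonnegative, so natural subtraction is exact,
   for l \<le> k \<le> n; only these values are used. *)
definition p_coeff :: "nat \<Rightarrow> nat \<Rightarrow> nat \<Rightarrow> real" where
  "p_coeff n k l =
     (fact (n + k + 1 - 2 * l) * fact (2 * n + 1 - k - l)) / (fact (k - l) * fact (3 * n + 2 - k - 2 * l))
     * (-1) ^ k * (3 * real n - 3 * real k + 2) * catalan (n - k)"

(* \<rho> is the radius of the positively oriented circle around 0. *)
definition h0b :: "real \<Rightarrow> nat \<Rightarrow> nat \<Rightarrow> complex" where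
  "h0b \<rho> n i = - of_nat ((i + 1) mod 2) +
     (\<Sum>k = 0..n. of_real (p_coeff n k 0) *
        (1 / (2 * of_real pi * \<i>) *
         contour_integral (circlepath 0 \<rho>)
           (\<lambda>r. (1 + r) ^ (n - k) / ((1 - r) * r powi (int i - 2 * int k)))))"

definition h1b :: "real \<Rightarrow> nat \<Rightarrow> nat \<Rightarrow> complex" where
  "h1b \<rho> n i =
     (\<Sum>k = 0..n. of_real (p_coeff n k 0) *
        (1 / (2 * of_real pi * \<i>) *
         contour_integral (circlepath 0 \<rho>)
           (\<lambda>r. (1 + r) ^ (n - k) / r powi (int i - 2 * int k + 1))))"

definition vertex_b :: "nat \<Rightarrow> vertex" where
  "vertex_b n = (2 * int n, 2 * int n + 1 - int n mod 2)"

end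

theory Submission
  imports Defs
begin

text \<open>
  A column of the inverse matrix is the only vector \<open>v\<close> that the Kasteleyn matrix sends to the unit
  vector at \<open>b\<close>, so it suffices to exhibit such a \<open>v\<close>. Let
  \<open>H(r) = \<Sum>\<^sub>k p(n,k,0) r\<^sup>2\<^sup>k (1 + r)\<^sup>n\<^sup>-\<^sup>k\<close>. The contour integrals extract coefficients: \<open>h\<^sup>1(i)\<close> is the
  coefficient of \<open>r\<^sup>i\<close> in \<open>H\<close>, and \<open>h\<^sup>0\<close> has the generating function
  \<open>H\<^sub>0 = r H / (1 - r) - 1 / (1 - r\<^sup>2)\<close>. The vector proposed for \<open>v\<close> takes at \<open>(i, i + 2j + 1)\<close> the
  coefficient of \<open>r\<^sup>i\<close> in \<open>(-1)\<^sup>j H / (1 + r)\<^sup>j\<close>, and at \<open>(i, i + 2j)\<close> the coefficient of \<open>r\<^sup>i\<^sup>+\<^sup>j\<close> in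
  \<open>(-1)\<^sup>j H\<^sub>0 (1 + r)\<^sup>j\<close>; it is \<open>0\<close> at \<open>(2n, 2n + 1)\<close>.

  In the interior of the graph the linear system holds by construction. Off the diagonal its
  equations say that raising \<open>j\<close> by one divides by \<open>-(1 + r)\<close>, respectively multiplies by it. On the
  diagonal they say \<open>h\<^sup>0(i + 2) - h\<^sup>0(i) = h\<^sup>1(i) + h\<^sup>1(i + 1)\<close>, which is how \<open>H\<^sub>0\<close> arises from \<open>H\<close>.
  So everything is decided on the top row \<open>x\<^sub>2 = 2n + 1\<close> and in the corner.

  On the top row one neighbour is missing, and the value that the formula would give there has to be
  \<open>0\<close>. At odd vertices outside the graph this holds for each summand of \<open>H\<close> separately, since
  \<open>(1 + r)\<^sup>N\<close> has no coefficient of index \<open>2N + 1\<close> for any integer \<open>N \<ge> 0\<close> and none of negative index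
  (\<open>odd_entry_top\<close>). At even vertices it is a property of the numbers \<open>p(n,k,0)\<close>: the coefficient of
  \<open>r\<^sup>2\<^sup>n\<^sup>+\<^sup>1\<^sup>-\<^sup>j\<close> in \<open>H (1 + r)\<^sup>j / (1 - r)\<close> must be \<open>2\<^sup>j\<^sup>-\<^sup>1\<close> for \<open>1 \<le> j \<le> n + 1\<close>
  (\<open>h1_series_partial_sums\<close>). As \<open>(1 + r) / (1 - r) = 2 / (1 - r) - 1\<close>, passing from \<open>j\<close> to \<open>j + 1\<close>
  doubles this coefficient up to a correction, and the correction is a multiple of the hypergeometric sum
  \<open>\<Sum>\<^sub>k p(n,k,0) (M + j)! / ((2M + 1 - j)! (2j - M)!)\<close> with \<open>M = n - k\<close>, which vanishes
  (\<open>boundary_sum_eq_0\<close>). The start of the recursion, and the corner equation, amount to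
  \<open>H(1) = \<Sum>\<^sub>k p(n,k,0) 2\<^sup>n\<^sup>-\<^sup>k\<close> being \<open>1\<close> for even and \<open>0\<close> for odd \<open>n\<close> (\<open>p_coeff_power_sum\<close>).

  Both sums are evaluated by creative telescoping. A linear combination of the summands for two
  consecutive values, of \<open>j\<close> for the first sum and of \<open>n\<close> for the second, is the difference in \<open>M\<close> of a
  hypergeometric term (\<open>boundary_term_telescopes\<close>,
  \<open>catalan_weight_partial_sum\<close>); the resulting first-order recurrences give the values.
\<close>

section \<open>The weights of the coefficients p(n,k,0)\<close>

text \<open>
  Up to the factor \<open>(-1)\<^sup>n (3M + 2) / 2\<close> this is \<open>p(n, n - M, 0)\<close> with \<open>N = n + 1\<close>. In this form the
  dependence on \<open>N\<close> is a product of \<open>M\<close> factors instead of a quotient of factorials, so that it makes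
  sense for all \<open>M\<close> and vanishes, for an integer \<open>N \<ge> 1\<close>, from \<open>M = N\<close> on, which ends the telescoping sums below.
\<close>
definition catalan_weight :: "real \<Rightarrow> nat \<Rightarrow> real" where
  "catalan_weight N M = (-1) ^ M * catalan M * (\<Prod>t=1..M. (N\<^sup>2 - (real t)\<^sup>2) / (4 * N\<^sup>2 - (real t)\<^sup>2))"

lemma catalan_Suc: "(real m + 2) * catalan (Suc m) = 2 * (2 * real m + 1) * catalan m"
proof -
  have c: "real ((2 * m) choose m) = fact (2 * m) / (fact m * fact m)" for m
    by (subst binomial_fact) (auto simp: mult_2)
  have f: "fact (2 * Suc m) = (2 * real m + 2) * (2 * real m + 1) * (fact (2 * m) :: real)"
    by (simp add: algebra_simps)
  show ?thesis
    unfolding catalan_def c f fact_Suc by (simp add: divide_simps) (simp add: algebra_simps)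
qed

lemma catalan_weight_0 [simp]: "catalan_weight N 0 = 1"
  by (simp add: catalan_weight_def catalan_def)

lemma catalan_weight_Suc:
  assumes "4 * N\<^sup>2 \<noteq> (real M + 1)\<^sup>2"
  shows "(real M + 2) * (4 * N\<^sup>2 - (real M + 1)\<^sup>2) * catalan_weight N (Suc M) =
         - 2 * (2 * real M + 1) * (N\<^sup>2 - (real M + 1)\<^sup>2) * catalan_weight N M"
proof -
  define P where "P = (\<Prod>t=1..M. (N\<^sup>2 - (real t)\<^sup>2) / (4 * N\<^sup>2 - (real t)\<^sup>2))"
  have w: "catalan_weight N (Suc M) = - ((-1) ^ M) * catalan (Suc M) * P * ((N\<^sup>2 - (real M + 1)\<^sup>2) / (4 * N\<^sup>2 - (real M + 1)\<^sup>2))"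
    by (simp add: catalan_weight_def P_def add.commute)
  have "(real M + 2) * (4 * N\<^sup>2 - (real M + 1)\<^sup>2) * catalan_weight N (Suc M) =
      - ((-1) ^ M) * ((real M + 2) * catalan (Suc M)) * P * (N\<^sup>2 - (real M + 1)\<^sup>2)"
    unfolding w using assms by (simp add: field_simps)
  also have "\<dots> = - 2 * (2 * real M + 1) * (N\<^sup>2 - (real M + 1)\<^sup>2) * catalan_weight N M"
    unfolding catalan_Suc catalan_weight_def P_def[symmetric] by (simp add: algebra_simps)
  finally show ?thesis .
qed

lemma catalan_weight_eq_0: "catalan_weight (real N) M = 0" if "1 \<le> N" "N \<le> M"
  using that by (auto simp: catalan_weight_def)

text \<open>The denominators of the weights do not vanish in the range that is needed.\<close>
lemma square_of_nat_neq: "4 * (real N)\<^sup>2 \<noteq> (real m)\<^sup>2" if "m < 2 * N"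
proof -
  have "(real m)\<^sup>2 < (2 * real N)\<^sup>2"
    using that by (intro power_strict_mono) auto
  then show ?thesis by (simp add: power_mult_distrib)
qed

lemma catalan_weight_Suc_nat:
  assumes "Suc M < 2 * N"
  shows "(real M + 2) * (4 * (real N)\<^sup>2 - (real M + 1)\<^sup>2) * catalan_weight (real N) (Suc M) =
         - 2 * (2 * real M + 1) * ((real N)\<^sup>2 - (real M + 1)\<^sup>2) * catalan_weight (real N) M"
  using square_of_nat_neq[OF assms] by (intro catalan_weight_Suc) (simp add: add.commute)

text \<open>
  The factorials in \<open>p(n, n - M, 0)\<close> form the quotient of the products of \<open>n + 1 + t\<close> and of
  \<open>2n + 2 + t\<close> over \<open>-M \<le> t \<le> M\<close>. Pairing \<open>t\<close> with \<open>-t\<close> gives the factors of the weight, and \<open>t = 0\<close>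
  the factor \<open>1/2\<close>.
\<close>
lemma p_coeff_eq_weight:
  assumes "M \<le> n"
  shows "p_coeff n (n - M) 0 = (-1) ^ n / 2 * (3 * real M + 2) * catalan_weight (real n + 1) M"
proof -
  define r where "r M = (fact (2 * n + 1 - M) * fact (n + 1 + M)) / (fact (n - M) * fact (2 * n + 2 + M) :: real)" for M
  have "r M = 1 / 2 * (\<Prod>t=1..M. ((real n + 1)\<^sup>2 - (real t)\<^sup>2) / (4 * (real n + 1)\<^sup>2 - (real t)\<^sup>2))"
    using assms
  proof (induction M)
    case 0
    have "fact (2 * n + 2) = (2 * real n + 2) * (fact (2 * n + 1) :: real)"
      using fact_Suc[of "2 * n + 1", where ?'a = real] by simp
    moreover have "fact (n + 1) = (real n + 1) * (fact n :: real)"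
      by simp
    ultimately show ?case by (simp add: r_def divide_simps del: fact_Suc)
  next
    case (Suc M)
    then obtain d where d: "n = M + 1 + d"
      by (metis add.commute le_Suc_ex Suc_eq_plus1)
    have e: "2 * n + 1 - M = Suc (Suc (M + 2 * d + 1))" "2 * n + 1 - Suc M = Suc (M + 2 * d + 1)"
      "n + 1 + Suc M = Suc (n + 1 + M)" "n - M = Suc d" "n - Suc M = d" "2 * n + 2 + Suc M = Suc (2 * n + 2 + M)"
      using d by auto
    have "r (Suc M) = r M * ((real n + M + 2) * (real d + 1) / ((real M + 2 * d + 3) * (2 * real n + M + 3)))"
      unfolding r_def e fact_Suc by (simp add: divide_simps) (simp add: algebra_simps)
    also have "(real n + M + 2) * (real d + 1) = (real n + 1)\<^sup>2 - (real (Suc M))\<^sup>2"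
      unfolding d by (simp add: power2_eq_square algebra_simps)
    also have "(real M + 2 * d + 3) * (2 * real n + M + 3) = 4 * (real n + 1)\<^sup>2 - (real (Suc M))\<^sup>2"
      unfolding d by (simp add: power2_eq_square algebra_simps)
    finally show ?case using Suc by simp
  qed
  moreover have "(-1 :: real) ^ (n - M) = (-1) ^ n * (-1) ^ M"
    using assms by (metis (no_types, lifting) le_add_diff_inverse2 minus_one_mult_self mult.assoc mult.right_neutral power_add)
  moreover have "p_coeff n (n - M) 0 = r M * (-1) ^ (n - M) * (3 * real M + 2) * catalan M"
  proof -
    have "n + (n - M) + 1 - 2 * 0 = 2 * n + 1 - M" "2 * n + 1 - (n - M) - 0 = n + 1 + M"
      "n - M - 0 = n - M" "3 * n + 2 - (n - M) - 2 * 0 = 2 * n + 2 + M" "n - (n - M) = M"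
      using assms by auto
    moreover have "3 * real n - 3 * real (n - M) + 2 = 3 * real M + 2"
      using assms by (simp add: of_nat_diff)
    ultimately show ?thesis by (simp only: p_coeff_def r_def)
  qed
  ultimately show ?thesis
    by (simp add: catalan_weight_def)
qed

section \<open>The value of the generating polynomial at one\<close>

text \<open>
  The relation is between products rather than a formula for a quotient because at \<open>M = N\<close> the weight for \<open>N\<close> vanishes while the one for
  \<open>N + 1\<close> does not.
\<close>
lemma catalan_weight_shift:
  assumes "M \<le> N" "1 \<le> N"
  shows "catalan_weight (real N) M * (real N + M + 1) * (2 * real N - M) * (2 * real N - M + 1) =
         catalan_weight (real N + 1) M * (real N - M) * (2 * real N + M + 1) * (2 * real N + M + 2)"
  using assms(1)
proof (induction M)
  case 0
  then show ?case by (simp add: algebra_simps)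
next
  case (Suc M)
  let ?N = "real N" and ?M = "real M"
  define c where "c = (?M + 2) * (4 * ?N\<^sup>2 - (?M + 1)\<^sup>2) * (4 * (?N + 1)\<^sup>2 - (?M + 1)\<^sup>2)"
  have sq: "4 * ?N\<^sup>2 \<noteq> (?M + 1)\<^sup>2" "4 * (?N + 1)\<^sup>2 \<noteq> (?M + 1)\<^sup>2"
    using square_of_nat_neq[of "Suc M" N] square_of_nat_neq[of "Suc M" "Suc N"] Suc.prems
    by (auto simp: add.commute)
  have c0: "c \<noteq> 0" using sq by (auto simp: c_def)
  have w: "(?M + 2) * (4 * ?N\<^sup>2 - (?M + 1)\<^sup>2) * catalan_weight ?N (Suc M) =
         - 2 * (2 * ?M + 1) * (?N\<^sup>2 - (?M + 1)\<^sup>2) * catalan_weight ?N M"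
    by (rule catalan_weight_Suc) (use sq in simp)
  have w': "(?M + 2) * (4 * (?N + 1)\<^sup>2 - (?M + 1)\<^sup>2) * catalan_weight (?N + 1) (Suc M) =
         - 2 * (2 * ?M + 1) * ((?N + 1)\<^sup>2 - (?M + 1)\<^sup>2) * catalan_weight (?N + 1) M"
    by (rule catalan_weight_Suc) (use sq in simp)
  have IH: "catalan_weight ?N M * (?N + ?M + 1) * (2 * ?N - ?M) * (2 * ?N - ?M + 1) =
         catalan_weight (?N + 1) M * (?N - ?M) * (2 * ?N + ?M + 1) * (2 * ?N + ?M + 2)"
    using Suc.IH Suc.prems by simp
  have "c * (catalan_weight ?N (Suc M) * (?N + (?M + 1) + 1) * (2 * ?N - (?M + 1)) * (2 * ?N - (?M + 1) + 1))
    = (4 * (?N + 1)\<^sup>2 - (?M + 1)\<^sup>2) * (?N + ?M + 2) * (2 * ?N - ?M - 1) * (2 * ?N - ?M) *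
      ((?M + 2) * (4 * ?N\<^sup>2 - (?M + 1)\<^sup>2) * catalan_weight ?N (Suc M))"
    unfolding c_def by algebra
  also have "\<dots> = - 2 * (2 * ?M + 1) * (2 * ?N + ?M + 3) * (?N - ?M - 1) * (?N + ?M + 2) * (2 * ?N - ?M - 1) *
      (catalan_weight ?N M * (?N + ?M + 1) * (2 * ?N - ?M) * (2 * ?N - ?M + 1))"
    unfolding w by algebra
  also have "\<dots> = (4 * ?N\<^sup>2 - (?M + 1)\<^sup>2) * (?N - ?M - 1) * (2 * ?N + ?M + 2) * (2 * ?N + ?M + 3) *
      ((?M + 2) * (4 * (?N + 1)\<^sup>2 - (?M + 1)\<^sup>2) * catalan_weight (?N + 1) (Suc M))"
    unfolding IH w' by algebra
  also have "\<dots> = c * (catalan_weight (?N + 1) (Suc M) * (?N - (?M + 1)) * (2 * ?N + (?M + 1) + 1) * (2 * ?N + (?M + 1) + 2))"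
    unfolding c_def by algebra
  finally show ?case using c0 by (simp add: add.commute)
qed

text \<open>
  The terms for \<open>N\<close> and for \<open>N + 1\<close> together telescope: the subtracted expression is a rational multiple of
  the weight for \<open>N + 1\<close>, as supplied by Gosper's algorithm, and the constant \<open>2\<close> is its value at \<open>m = 0\<close>.
  The induction step becomes an identity of rational functions once all weights are expressed through
  the one for \<open>N + 1\<close> at \<open>M\<close>.
\<close>
lemma catalan_weight_partial_sum:
  assumes "m \<le> Suc N" "1 \<le> N"
  shows "(\<Sum>M<m. 2 ^ M * (3 * real M + 2) * (catalan_weight (real N) M + catalan_weight (real N + 1) M)) =
     2 - (2 * real N + 1) * (real m + 1) * (2 * real N + real m + 2) * 2 ^ m * catalan_weight (real N + 1) m /
         ((real N + m + 1) * (2 * real N + 1 - m))"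
  using assms(1)
proof (induction m)
  case 0
  have "(2 * real N + 1) * (2 * real N + 2) / ((real N + 1) * (2 * real N + 1)) = 2"
    by (simp add: divide_simps)
  then show ?case by simp
next
  case (Suc M)
  let ?N = "real N" and ?M = "real M"
  have le: "?M \<le> ?N" "?N \<ge> 1" using Suc.prems assms by linarith+
  define d1 d2 d3 d4 where "d1 = ?N + ?M + 1" and "d2 = 2 * ?N - ?M" and "d3 = 2 * ?N + 1 - ?M"
    and "d4 = 2 * ?N + ?M + 3"
  have d: "d1 \<noteq> 0" "d2 \<noteq> 0" "d3 \<noteq> 0" "d4 \<noteq> 0" "?M + 2 \<noteq> 0" "?N + ?M + 2 \<noteq> 0" "?N + (?M + 1) + 1 \<noteq> 0"
    using le by (simp_all add: d1_def d2_def d3_def d4_def)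
  have sq: "4 * (?N + 1)\<^sup>2 \<noteq> (?M + 1)\<^sup>2"
    using square_of_nat_neq[of "Suc M" "Suc N"] Suc.prems assms by (auto simp: add.commute)
  \<comment> \<open>\<open>q\<close> and \<open>t\<close> are the ratios of the weights at \<open>(N, M)\<close> and \<open>(N + 1, M + 1)\<close> to the weight at \<open>(N + 1, M)\<close>;
    \<open>P\<close> and \<open>Q\<close> are the rational factors of the subtracted expression at \<open>M\<close> and \<open>M + 1\<close>.\<close>
  define q t P Q where "q = (?N - ?M) * (2 * ?N + ?M + 1) * (2 * ?N + ?M + 2) / (d1 * d2 * d3)"
    and "t = - 2 * (2 * ?M + 1) * ((?N - ?M) * (?N + ?M + 2)) / ((?M + 2) * (d3 * d4))"
    and "P = (2 * ?N + 1) * (?M + 1) * (2 * ?N + ?M + 2) / (d1 * d3)"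
    and "Q = (2 * ?N + 1) * (?M + 2) * d4 * 2 / ((?N + ?M + 2) * d2)"
  have a: "catalan_weight ?N M = catalan_weight (?N + 1) M * q"
  proof -
    have "catalan_weight ?N M * (d1 * d2 * d3) =
        catalan_weight (?N + 1) M * ((?N - ?M) * (2 * ?N + ?M + 1) * (2 * ?N + ?M + 2))"
      using catalan_weight_shift[of M N] Suc.prems assms unfolding d1_def d2_def d3_def
      by (simp add: algebra_simps)
    then show ?thesis using d by (simp add: nonzero_eq_divide_eq q_def)
  qed
  have ratio: "(?M + 2) * (d3 * d4) * catalan_weight (?N + 1) (Suc M) =
         - 2 * (2 * ?M + 1) * ((?N - ?M) * (?N + ?M + 2)) * catalan_weight (?N + 1) M"
    using catalan_weight_Suc[OF sq] unfolding d3_def d4_def by algebra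
  have b: "catalan_weight (?N + 1) (Suc M) = catalan_weight (?N + 1) M * t"
  proof -
    have "catalan_weight (?N + 1) (Suc M) * ((?M + 2) * (d3 * d4)) =
        catalan_weight (?N + 1) M * (- 2 * (2 * ?M + 1) * ((?N - ?M) * (?N + ?M + 2)))"
      using ratio by (simp only: mult_ac)
    then show ?thesis using d by (simp add: nonzero_eq_divide_eq t_def)
  qed
  have "(3 * ?M + 2) * ((?N - ?M) * (2 * ?N + ?M + 1) * (2 * ?N + ?M + 2) / (d1 * d2 * d3) + 1)
    = (2 * ?N + 1) * (?M + 1) * (2 * ?N + ?M + 2) / (d1 * d3)
      - (2 * ?N + 1) * (?M + 2) * d4 * 2 / ((?N + ?M + 2) * d2) *
        (- 2 * (2 * ?M + 1) * ((?N - ?M) * (?N + ?M + 2)) / ((?M + 2) * (d3 * d4)))"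
     (is "?lhs = ?rhs")
  proof -
    have "?rhs = (2 * ?N + 1) * (?M + 1) * (2 * ?N + ?M + 2) / (d1 * d3)
      + (2 * ?N + 1) * 4 * (2 * ?M + 1) * (?N - ?M) / (d2 * d3)"
      using d by (simp add: divide_simps) (simp add: algebra_simps)
    also have "\<dots> = ((2 * ?N + 1) * (?M + 1) * (2 * ?N + ?M + 2) * d2 + (2 * ?N + 1) * 4 * (2 * ?M + 1) * (?N - ?M) * d1) / (d1 * d2 * d3)"
      using d by (simp add: divide_simps)
    also have "(2 * ?N + 1) * (?M + 1) * (2 * ?N + ?M + 2) * d2 + (2 * ?N + 1) * 4 * (2 * ?M + 1) * (?N - ?M) * d1
       = (3 * ?M + 2) * ((?N - ?M) * (2 * ?N + ?M + 1) * (2 * ?N + ?M + 2) + d1 * d2 * d3)"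
      unfolding d1_def d2_def d3_def d4_def by algebra
    also have "\<dots> / (d1 * d2 * d3) = ?lhs"
      using d by (simp add: divide_simps)
    finally show ?thesis by simp
  qed
  then have key: "(3 * ?M + 2) * (q + 1) = P - Q * t"
    unfolding q_def P_def Q_def t_def .
  have "2 ^ M * (3 * ?M + 2) * (catalan_weight ?N M + catalan_weight (?N + 1) M) =
      2 ^ M * catalan_weight (?N + 1) M * ((3 * ?M + 2) * (q + 1))"
    unfolding a by algebra
  also have "\<dots> = P * (2 ^ M * catalan_weight (?N + 1) M) - Q * (2 ^ M * catalan_weight (?N + 1) (Suc M))"
    unfolding key b by algebra
  finally have e: "2 ^ M * (3 * ?M + 2) * (catalan_weight ?N M + catalan_weight (?N + 1) M) = \<dots>" .
  have i: "(\<Sum>M<M. 2 ^ M * (3 * real M + 2) * (catalan_weight (real N) M + catalan_weight (real N + 1) M)) =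
     2 - P * (2 ^ M * catalan_weight (?N + 1) M)"
    using Suc by (simp add: P_def d1_def d3_def)
  have r: "real (Suc M) + 1 = ?M + 2" "?N + real (Suc M) + 1 = ?N + ?M + 2"
    "2 * ?N + 1 - real (Suc M) = d2" "2 * ?N + real (Suc M) + 2 = d4"
    by (simp_all add: d2_def d4_def)
  show ?case unfolding sum.lessThan_Suc i e r by (simp add: Q_def)
qed

text \<open>
  At \<open>m = N + 1\<close> the subtracted term vanishes, so consecutive sums add up to \<open>2\<close>; the first one is \<open>2\<close>.
\<close>
lemma weighted_power_sum:
  assumes "1 \<le> N"
  shows "(\<Sum>M<N. 2 ^ M * (3 * real M + 2) * catalan_weight (real N) M) = (if odd N then 2 else 0)"
  using assms
proof (induction N rule: dec_induct)
  case base
  then show ?case by simp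
next
  case (step N)
  have "(\<Sum>M<Suc N. 2 ^ M * (3 * real M + 2) * (catalan_weight (real N) M + catalan_weight (real N + 1) M)) = 2"
    using catalan_weight_partial_sum[of "Suc N" N] catalan_weight_eq_0[of "Suc N" "Suc N"] step
    by (simp add: add.commute)
  then have "(\<Sum>M<N. 2 ^ M * (3 * real M + 2) * catalan_weight (real N) M)
     + (\<Sum>M<Suc N. 2 ^ M * (3 * real M + 2) * catalan_weight (real (Suc N)) M) = 2"
    using catalan_weight_eq_0[of N N] step by (simp add: distrib_left sum.distrib add.commute)
  then show ?case using step.IH by auto
qed

lemma p_coeff_power_sum: "(\<Sum>k\<le>n. p_coeff n k 0 * 2 ^ (n - k)) = (if even n then 1 else 0)"
proof -
  have "(\<Sum>k\<le>n. p_coeff n k 0 * 2 ^ (n - k)) = (\<Sum>M<Suc n. p_coeff n (n - M) 0 * 2 ^ M)"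
    by (subst sum.nat_diff_reindex[symmetric]) (auto simp: lessThan_Suc_atMost intro!: sum.cong)
  also have "\<dots> = (\<Sum>M<Suc n. (-1) ^ n / 2 * (2 ^ M * (3 * real M + 2) * catalan_weight (real (Suc n)) M))"
    by (intro sum.cong) (auto simp: p_coeff_eq_weight less_Suc_eq_le add.commute)
  also have "\<dots> = (if even n then 1 else 0)"
    unfolding sum_distrib_left[symmetric] by (subst weighted_power_sum) auto
  finally show ?thesis .
qed

section \<open>The sums that vanish at the top row\<close>

text \<open>
  The reciprocal Gamma function is the reciprocal factorial continued by \<open>0\<close> to negative integers.
  With it the formula for a binomial coefficient also covers the case where the lower index exceeds
  the upper one, so that sums over all \<open>M \<le> n\<close> need no case distinctions.
\<close>
lemma binomial_rGamma:
  "real (a choose b) = fact a * rGamma (real b + 1) * rGamma (real a - real b + 1)"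
proof (cases "b \<le> a")
  case True
  have g: "rGamma (real k + 1) = 1 / fact k" for k
    using Gamma_fact[of k, where ?'a = real] by (simp add: rGamma_inverse_Gamma inverse_eq_divide add.commute)
  have "real a - real b + 1 = real (a - b) + 1"
    using True by (simp add: of_nat_diff)
  then show ?thesis
    using True by (simp only: g) (simp add: binomial_fact)
next
  case False
  then have "real a - real b + 1 = - real (b - a - 1)"
    by (simp add: of_nat_diff)
  then have "rGamma (real a - real b + 1) = 0"
    by (simp only: rGamma_eq_zero_iff minus_of_nat_in_nonpos_Ints)
  then show ?thesis using False by simp
qed

lemma rGamma_step: "y = x + 1 \<Longrightarrow> rGamma x = x * rGamma (y :: real)"
  using rGamma_plus1[of x] by simp

lemma rGamma_step2: "y = x + 1 \<Longrightarrow> z = x + 2 \<Longrightarrow> rGamma x = x * y * rGamma (z :: real)"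
  using rGamma_step[of y x] rGamma_step[of z y] by simp

text \<open>
  In terms of factorials the last three factors are \<open>(M + j)! / ((2M + 1 - j)! (2j - M)!)\<close>, read as \<open>0\<close>
  if one of the two lower arguments is negative.
\<close>
definition boundary_term :: "nat \<Rightarrow> nat \<Rightarrow> nat \<Rightarrow> real" where
  "boundary_term N j M = (3 * real M + 2) * catalan_weight (real N) M * fact (M + j) *
      rGamma (2 * real M + 2 - real j) * rGamma (2 * real j + 1 - real M)"

text \<open>
  The certificate for the first-order recurrence in \<open>j\<close>. After division by the common hypergeometric
  factor \<open>u\<close> of all the terms, only a polynomial identity remains. The coefficients of the recurrence were
  found by evaluating that identity at \<open>M = -j - 1\<close> and \<open>M = 2j + 2\<close>, where one of the two terms drops out.
\<close>
lemma boundary_term_telescopes: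
  fixes N j M :: nat
  assumes "Suc M < 2 * N"
  defines "G \<equiv> \<lambda>M. (real M + 1) * (2 * real M - j) * (2 * real M + 1 - j) * (4 * (real N)\<^sup>2 - (real M)\<^sup>2) *
     catalan_weight (real N) M * fact (M + j) * rGamma (2 * real M + 2 - j) * rGamma (2 * real j + 3 - M)"
  shows "real j * (4 * (real N)\<^sup>2 - (real j + 1)\<^sup>2) * boundary_term N j M
    + 2 * (2 * real j + 3) * ((real N)\<^sup>2 - (real j + 1)\<^sup>2) * boundary_term N (Suc j) M
    = - 3 * (real j + 1) * (G (Suc M) - G M)"
proof -
  let ?N = "real N" and ?M = "real M" and ?j = "real j"
  define R S u where "R = rGamma (2 * ?M + 2 - ?j)" and "S = rGamma (2 * ?j + 3 - ?M)"
    and "u = catalan_weight ?N M * fact (M + j) * R * S"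
  have g: "rGamma (2 * ?j + 1 - ?M) = (2 * ?j + 1 - ?M) * (2 * ?j + 2 - ?M) * S"
    unfolding S_def by (rule rGamma_step2) simp_all
  have "rGamma (2 * ?M + 1 - ?j) = (2 * ?M + 1 - ?j) * R"
    unfolding R_def by (rule rGamma_step) simp
  moreover have "2 * ?M + 2 - real (Suc j) = 2 * ?M + 1 - ?j"
    by simp
  ultimately have g2: "rGamma (2 * ?M + 2 - real (Suc j)) = (2 * ?M + 1 - ?j) * R"
    by (simp only:)
  have g3: "(2 * ?M + 2 - ?j) * (2 * ?M + 3 - ?j) * rGamma (2 * real (Suc M) + 2 - ?j) = R"
    unfolding R_def by (rule rGamma_step2[symmetric]) simp_all
  have "rGamma (2 * ?j + 2 - ?M) = (2 * ?j + 2 - ?M) * S"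
    unfolding S_def by (rule rGamma_step) simp
  moreover have "2 * ?j + 3 - real (Suc M) = 2 * ?j + 2 - ?M"
    by simp
  ultimately have g4: "rGamma (2 * ?j + 3 - real (Suc M)) = (2 * ?j + 2 - ?M) * S"
    by (simp only:)
  have g5: "rGamma (2 * real (Suc j) + 1 - ?M) = S"
    by (simp add: S_def algebra_simps)
  have F: "boundary_term N j M = (3 * ?M + 2) * ((2 * ?j + 1 - ?M) * (2 * ?j + 2 - ?M)) * u"
    by (simp add: boundary_term_def g u_def R_def)
  have F': "boundary_term N (Suc j) M = (3 * ?M + 2) * ((?M + ?j + 1) * (2 * ?M + 1 - ?j)) * u"
    unfolding boundary_term_def g2 g5 by (simp add: u_def algebra_simps)
  have G: "G M = (?M + 1) * (2 * ?M - ?j) * (2 * ?M + 1 - ?j) * (4 * ?N\<^sup>2 - ?M\<^sup>2) * u"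
    by (simp add: G_def u_def R_def S_def)
  have "G (Suc M) = ((?M + 2) * (4 * ?N\<^sup>2 - (?M + 1)\<^sup>2) * catalan_weight ?N (Suc M)) * ((?M + ?j + 1) * fact (M + j)) *
      ((2 * ?M + 2 - ?j) * (2 * ?M + 3 - ?j) * rGamma (2 * real (Suc M) + 2 - ?j)) * rGamma (2 * ?j + 3 - real (Suc M))"
    unfolding G_def by (simp add: algebra_simps)
  also have "\<dots> = - 2 * (2 * ?M + 1) * (?N\<^sup>2 - (?M + 1)\<^sup>2) * (?M + ?j + 1) * (2 * ?j + 2 - ?M) * u"
    unfolding catalan_weight_Suc_nat[OF assms(1)] g3 g4 by (simp add: u_def)
  finally have G': "G (Suc M) = \<dots>" .
  show ?thesis unfolding F F' G G' by algebra
qed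

text \<open>
  \<open>G\<close> vanishes at both ends of the summation: at \<open>M = 0\<close> because of the reciprocal of \<open>(-1 - j)!\<close>, and at
  \<open>M = n + 1\<close> because the weight does. The resulting recurrence carries the factor \<open>j\<close> in front of the
  sum for \<open>j\<close>, so the nonzero sum for \<open>j = 0\<close> does no harm. The factor of the next sum is nonzero exactly
  as long as \<open>j + 1 \<noteq> n + 1\<close>, which is where the range of validity ends.
\<close>
lemma boundary_sum_eq_0:
  assumes "1 \<le> j" "j \<le> n"
  shows "(\<Sum>M\<le>n. boundary_term (Suc n) j M) = 0"
  using assms
proof (induction j)
  case 0
  then show ?case by simp
next
  case (Suc j)
  let ?N = "real (Suc n)"
  let ?s = "\<lambda>j. \<Sum>M\<le>n. boundary_term (Suc n) j M"
  define G where "G = (\<lambda>M. (real M + 1) * (2 * real M - j) * (2 * real M + 1 - j) * (4 * ?N\<^sup>2 - (real M)\<^sup>2) *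
     catalan_weight ?N M * fact (M + j) * rGamma (2 * real M + 2 - j) * rGamma (2 * real j + 3 - M))"
  have "real j * (4 * ?N\<^sup>2 - (real j + 1)\<^sup>2) * ?s j
      + 2 * (2 * real j + 3) * (?N\<^sup>2 - (real j + 1)\<^sup>2) * ?s (Suc j)
     = (\<Sum>M\<le>n. real j * (4 * ?N\<^sup>2 - (real j + 1)\<^sup>2) * boundary_term (Suc n) j M
    + 2 * (2 * real j + 3) * (?N\<^sup>2 - (real j + 1)\<^sup>2) * boundary_term (Suc n) (Suc j) M)"
    by (simp only: sum.distrib sum_distrib_left)
  also have "\<dots> = (\<Sum>M\<le>n. - 3 * (real j + 1) * (G (Suc M) - G M))"
    unfolding G_def by (intro sum.cong refl boundary_term_telescopes) auto
  also have "\<dots> = - 3 * (real j + 1) * (G (Suc n) - G 0)"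
    unfolding sum_distrib_left[symmetric] using sum_lessThan_telescope[of G "Suc n"] by (simp only: lessThan_Suc_atMost)
  also have "G (Suc n) = 0"
    using catalan_weight_eq_0[of "Suc n" "Suc n"] by (simp add: G_def del: of_nat_Suc)
  also have "G 0 = 0"
  proof -
    have "(2 * real 0 - j) * (2 * real 0 + 1 - j) * rGamma (2 * real 0 + 2 - j) = rGamma (- real j)"
      using rGamma_step2[of "1 - real j" "- real j" "2 - real j"] by simp
    also have "\<dots> = 0"
      by (simp add: rGamma_eq_zero_iff)
    finally show ?thesis
      unfolding G_def mult_eq_0_iff by blast
  qed
  also have "real j * (4 * ?N\<^sup>2 - (real j + 1)\<^sup>2) * ?s j = 0"
    using Suc by (cases "j = 0") auto
  finally have "2 * (2 * real j + 3) * (?N\<^sup>2 - (real j + 1)\<^sup>2) * ?s (Suc j) = 0"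
    by simp
  moreover have "?N\<^sup>2 - (real j + 1)\<^sup>2 \<noteq> 0"
    using Suc.prems by (simp add: power2_eq_iff)
  ultimately show ?case by (simp add: add_eq_0_iff)
qed

section \<open>The contour integrals as coefficients of power series\<close>

lemma one_plus_power_deriv:
  "(deriv ^^ d) (\<lambda>r. (1 + r :: complex) ^ N) = (\<lambda>r. fact d * of_nat (N choose d) * (1 + r) ^ (N - d))"
proof (induction d)
  case 0
  then show ?case by simp
next
  case (Suc d)
  show ?case
  proof
    fix r :: complex
    have D: "((\<lambda>r. fact d * of_nat (N choose d) * (1 + r) ^ (N - d)) has_field_derivative
       (fact d * of_nat (N choose d) * (of_nat (N - d) * (1 + r) ^ (N - d - 1)))) (at r)"
      by (auto intro!: derivative_eq_intros)
    have "(N choose d) * (N - d) = Suc d * (N choose Suc d)"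
      by (metis binomial_absorb_comp binomial_absorption mult.commute)
    then have "of_nat (N choose d) * of_nat (N - d) = (of_nat (Suc d) * of_nat (N choose Suc d) :: complex)"
      by (metis of_nat_mult)
    then have "fact d * of_nat (N choose d) * (of_nat (N - d) * (1 + r) ^ (N - d - 1)) =
       fact (Suc d) * of_nat (N choose Suc d) * (1 + r) ^ (N - Suc d)"
      by (simp add: mult.assoc flip: mult.assoc[of "of_nat (N choose d)"])
    with DERIV_imp_deriv[OF D] show "(deriv ^^ Suc d) (\<lambda>r. (1 + r :: complex) ^ N) r = fact (Suc d) * of_nat (N choose Suc d) * (1 + r) ^ (N - Suc d)"
      by (simp add: Suc.IH)
  qed
qed

text \<open>
  Cauchy's formula for the derivatives at \<open>0\<close> if there is a pole; otherwise the integrand is entire.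
\<close>
lemma circle_integral_power_binomial:
  assumes "0 < \<rho>"
  shows "1 / (2 * of_real pi * \<i>) *
     contour_integral (circlepath 0 \<rho>) (\<lambda>r. (1 + r) ^ N / r powi (e + 1))
    = (if 0 \<le> e then of_nat (N choose nat e) else 0)"
proof (cases "0 \<le> e")
  case True
  then obtain d where d: "e = int d"
    using nonneg_int_cases by blast
  have "(deriv ^^ d) (\<lambda>r. (1 + r) ^ N) 0 = fact d / (2 * pi * \<i>) *
     contour_integral (circlepath 0 \<rho>) (\<lambda>u. (1 + u) ^ N / (u - 0) ^ Suc d)"
    using assms by (intro Cauchy_higher_derivative_integral_circlepath(2))
      (auto intro!: continuous_intros holomorphic_intros)
  moreover have "(\<lambda>r :: complex. (1 + r) ^ N / r powi (e + 1)) = (\<lambda>u. (1 + u) ^ N / (u - 0) ^ Suc d)"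
    unfolding d by (simp add: power_int_def nat_add_distrib fun_eq_iff)
  ultimately have "fact d * (of_nat (N choose d) :: complex) = fact d * (1 / (2 * of_real pi * \<i>) *
     contour_integral (circlepath 0 \<rho>) (\<lambda>r. (1 + r) ^ N / r powi (e + 1)))"
    unfolding one_plus_power_deriv by simp
  then show ?thesis
    using True by (simp only: mult_left_cancel[OF fact_nonzero] d nat_int if_True)
next
  case False
  have "(\<lambda>r :: complex. (1 + r) ^ N / r powi (e + 1)) = (\<lambda>r. (1 + r) ^ N * r ^ nat (- e - 1))"
    using False by (auto simp: fun_eq_iff power_int_def power_inverse divide_inverse)
  moreover have "contour_integral (circlepath 0 \<rho>) (\<lambda>r. (1 + r) ^ N * r ^ nat (- e - 1)) = 0"
    by (rule contour_integral_unique, rule Cauchy_theorem_convex_simple[of _ UNIV])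
      (auto intro!: holomorphic_intros)
  ultimately show ?thesis using False by simp
qed

text \<open>
  Because \<open>1 / (1 - r) = r / (1 - r) + 1\<close>, the integrals with the geometric factor are partial sums
  of those without it. This reduces them to binomial coefficients without expanding \<open>1 / (1 - r)\<close>.
\<close>
lemma circle_integral_geometric_Suc:
  assumes "0 < \<rho>" "\<rho> < 1"
  shows "contour_integral (circlepath 0 \<rho>) (\<lambda>r. (1 + r) ^ N / ((1 - r) * r powi (e + 1)))
    = contour_integral (circlepath 0 \<rho>) (\<lambda>r. (1 + r) ^ N / ((1 - r) * r powi e))
     + contour_integral (circlepath 0 \<rho>) (\<lambda>r. (1 + r) ^ N / r powi (e + 1))"
proof -
  let ?c = "circlepath 0 \<rho> :: real \<Rightarrow> complex"
  have 0: "r \<noteq> 0" "r \<noteq> 1" if "r \<in> path_image ?c" for r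
    using that assms by auto
  have int: "(\<lambda>r. (1 + r) ^ N / ((1 - r) * r powi e)) contour_integrable_on ?c"
    "(\<lambda>r. (1 + r) ^ N / r powi e) contour_integrable_on ?c" for e
    using 0 by (intro contour_integrable_continuous_circlepath continuous_intros; force)+
  have "contour_integral ?c (\<lambda>r. (1 + r) ^ N / ((1 - r) * r powi (e + 1))) =
     contour_integral ?c (\<lambda>r. (1 + r) ^ N / ((1 - r) * r powi e) + (1 + r) ^ N / r powi (e + 1))"
  proof (rule contour_integral_eq)
    fix r assume "r \<in> path_image ?c"
    from 0[OF this] have "r powi (e + 1) = r * r powi e" "1 - r \<noteq> 0" "r \<noteq> 0"
      by (simp_all add: power_int_add_1')
    then show "(1 + r) ^ N / ((1 - r) * r powi (e + 1)) =
      (1 + r) ^ N / ((1 - r) * r powi e) + (1 + r) ^ N / r powi (e + 1)"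
      by (simp add: divide_simps) (simp add: algebra_simps)
  qed
  then show ?thesis
    by (simp add: contour_integral_add int)
qed

lemma circle_integral_geometric_nonpos:
  assumes "0 < \<rho>" "\<rho> < 1" "e \<le> 0"
  shows "contour_integral (circlepath 0 \<rho>) (\<lambda>r. (1 + r) ^ N / ((1 - r) * r powi e)) = 0"
proof -
  have "(\<lambda>r :: complex. (1 + r) ^ N / ((1 - r) * r powi e)) = (\<lambda>r. (1 + r) ^ N * r ^ nat (- e) / (1 - r))"
    using assms(3) by (auto simp: fun_eq_iff power_int_def power_inverse divide_inverse)
  moreover have "contour_integral (circlepath 0 \<rho>) (\<lambda>r. (1 + r) ^ N * r ^ nat (- e) / (1 - r)) = 0"
    using assms by (intro contour_integral_unique Cauchy_theorem_convex_simple[of _ "ball 0 1"])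
      (auto intro!: holomorphic_intros)
  ultimately show ?thesis by simp
qed

definition h1_series :: "nat \<Rightarrow> real fps" where
  "h1_series n = (\<Sum>k\<le>n. fps_const (p_coeff n k 0) * (fps_X ^ (2 * k) * (1 + fps_X) ^ (n - k)))"

text \<open>
  This is \<open>r H / (1 - r) - 1 / (1 - r\<^sup>2)\<close> for \<open>H\<close> the series of the \<open>h\<^sup>1\<close>, written by coefficients.
\<close>
definition h0_series :: "nat \<Rightarrow> real fps" where
  "h0_series n = Abs_fps (\<lambda>i. (\<Sum>m<i. h1_series n $ m) - (if even i then 1 else 0))"

lemma one_plus_X_power_nth: "((1 + fps_X) ^ N :: real fps) $ m = real (N choose m)"
  using fps_binomial_nth[of "real N" m] unfolding fps_binomial_of_nat by (simp add: binomial_gbinomial)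

lemma h1_series_nth:
  "h1_series n $ i = (\<Sum>k\<le>n. p_coeff n k 0 * (if 2 * k \<le> i then real ((n - k) choose (i - 2 * k)) else 0))"
  unfolding h1_series_def fps_sum_nth
  by (intro sum.cong refl) (simp add: fps_X_power_mult_nth one_plus_X_power_nth)

lemma h1b_eq:
  assumes "0 < \<rho>"
  shows "h1b \<rho> n i = of_real (h1_series n $ i)"
proof -
  have "h1b \<rho> n i = (\<Sum>k = 0..n. of_real (p_coeff n k 0) *
     (if 0 \<le> int i - 2 * int k then of_nat ((n - k) choose nat (int i - 2 * int k)) else 0))"
    unfolding h1b_def circle_integral_power_binomial[OF assms] ..
  also have "\<dots> = of_real (h1_series n $ i)"
    unfolding h1_series_nth of_real_sum atLeast0AtMost
    by (intro sum.cong) (auto simp: nat_diff_distrib nat_mult_distrib)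
  finally show ?thesis .
qed

lemma h0b_eq:
  assumes "0 < \<rho>" "\<rho> < 1"
  shows "h0b \<rho> n i = of_real (h0_series n $ i)"
proof -
  define J where "J i = (\<Sum>k = 0..n. complex_of_real (p_coeff n k 0) *
        (1 / (2 * of_real pi * \<i>) *
         contour_integral (circlepath 0 \<rho>)
           (\<lambda>r. (1 + r) ^ (n - k) / ((1 - r) * r powi (int i - 2 * int k)))))" for i
  have "J i = of_real (\<Sum>m<i. h1_series n $ m)"
  proof (induction i)
    case 0
    have "contour_integral (circlepath 0 \<rho>)
           (\<lambda>r. (1 + r) ^ (n - k) / ((1 - r) * r powi (int 0 - 2 * int k))) = 0" for k
      by (rule circle_integral_geometric_nonpos[OF assms]) simp
    then show ?case by (simp add: J_def del: of_nat_0)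
  next
    case (Suc i)
    have "int (Suc i) - 2 * int k = int i - 2 * int k + 1" for k
      by simp
    then have "J (Suc i) = J i + h1b \<rho> n i"
      unfolding J_def h1b_def by (simp only: circle_integral_geometric_Suc[OF assms] distrib_left sum.distrib)
    then show ?case
      by (simp add: Suc h1b_eq[OF assms(1)])
  qed
  moreover have "(of_nat ((i + 1) mod 2) :: complex) = (if even i then 1 else 0)"
    by (auto simp: mod_2_eq_odd)
  ultimately show ?thesis
    by (simp add: h0b_def J_def h0_series_def)
qed

section \<open>Coefficients of the generating series at the boundary\<close>

lemma h1_series_shift_nth:
  assumes "j \<le> 2 * n + 1"
  shows "(h1_series n * (1 + fps_X) ^ i) $ (2 * n + 1 - j) =
    (\<Sum>M\<le>n. p_coeff n (n - M) 0 * (if j \<le> 2 * M + 1 then real ((M + i) choose (2 * M + 1 - j)) else 0))"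
proof -
  have "(h1_series n * (1 + fps_X) ^ i) $ (2 * n + 1 - j) =
     (\<Sum>k\<le>n. p_coeff n k 0 * ((fps_X ^ (2 * k) * (1 + fps_X) ^ (n - k + i)) $ (2 * n + 1 - j)))"
    unfolding h1_series_def sum_distrib_right fps_sum_nth
    by (simp only: mult.assoc power_add fps_mult_left_const_nth)
  also have "\<dots> = (\<Sum>M\<le>n. p_coeff n (n - M) 0 * ((fps_X ^ (2 * (n - M)) * (1 + fps_X) ^ (n - (n - M) + i)) $ (2 * n + 1 - j)))"
    using sum.nat_diff_reindex[of "\<lambda>k. p_coeff n k 0 * ((fps_X ^ (2 * k) * (1 + fps_X) ^ (n - k + i)) $ (2 * n + 1 - j))" "Suc n"]
    by (simp add: lessThan_Suc_atMost)
  also have "\<dots> = (\<Sum>M\<le>n. p_coeff n (n - M) 0 * (if j \<le> 2 * M + 1 then real ((M + i) choose (2 * M + 1 - j)) else 0))"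
  proof (intro sum.cong refl)
    fix M assume "M \<in> {..n}"
    then have M: "M \<le> n" by simp
    have "2 * n + 1 - j < 2 * (n - M) \<longleftrightarrow> \<not> j \<le> 2 * M + 1" "2 * n + 1 - j - 2 * (n - M) = 2 * M + 1 - j" "n - (n - M) = M"
      using M assms by auto
    then show "p_coeff n (n - M) 0 * ((fps_X ^ (2 * (n - M)) * (1 + fps_X) ^ (n - (n - M) + i)) $ (2 * n + 1 - j)) =
       p_coeff n (n - M) 0 * (if j \<le> 2 * M + 1 then real ((M + i) choose (2 * M + 1 - j)) else 0)"
      by (simp add: fps_X_power_mult_nth one_plus_X_power_nth)
  qed
  finally show ?thesis .
qed

text \<open>
  The two binomial coefficients differ only in the upper index, and their sum is a single term times
  \<open>(2j - M) + (M + j + 1)\<close>. This factor does not depend on \<open>M\<close>, so that the sum over \<open>M\<close> is a multiple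
  of the sum of \<open>boundary_term\<close>.
\<close>
lemma adjacent_binomials:
  "(if j \<le> 2 * M + 1 then real ((M + j) choose (2 * M + 1 - j)) + real ((M + Suc j) choose (2 * M + 1 - j)) else 0)
   = (3 * real j + 1) * (fact (M + j) * rGamma (2 * real M + 2 - real j) * rGamma (2 * real j + 1 - real M))"
proof (cases "j \<le> 2 * M + 1")
  case True
  then have b: "real (2 * M + 1 - j) = 2 * real M + 1 - real j"
    by (simp add: of_nat_diff)
  have e: "2 * real M + 1 - real j + 1 = 2 * real M + 2 - real j"
    "real (M + j) - (2 * real M + 1 - real j) + 1 = 2 * real j - real M"
    "real (M + Suc j) - (2 * real M + 1 - real j) + 1 = 2 * real j + 1 - real M"
    "fact (M + Suc j) = (real M + real j + 1) * fact (M + j)"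
    by (simp_all add: algebra_simps)
  have g: "rGamma (2 * real j - real M) = (2 * real j - real M) * rGamma (2 * real j + 1 - real M)"
    by (rule rGamma_step) simp
  show ?thesis
    using True unfolding binomial_rGamma b e g by (simp add: algebra_simps)
next
  case False
  then have "2 * real M + 2 - real j = - real (j - 2 * M - 2)"
    by (simp add: of_nat_diff)
  then have "rGamma (2 * real M + 2 - real j) = 0"
    by (simp only: rGamma_eq_zero_iff minus_of_nat_in_nonpos_Ints)
  then show ?thesis using False by simp
qed

lemma h1_series_cancellation:
  assumes "1 \<le> j" "j \<le> n"
  shows "(h1_series n * (1 + fps_X) ^ j) $ (2 * n + 1 - j) +
    (h1_series n * (1 + fps_X) ^ Suc j) $ (2 * n + 1 - j) = 0"
proof -
  have "(h1_series n * (1 + fps_X) ^ j) $ (2 * n + 1 - j) +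
      (h1_series n * (1 + fps_X) ^ Suc j) $ (2 * n + 1 - j) =
     (\<Sum>M\<le>n. p_coeff n (n - M) 0 *
       (if j \<le> 2 * M + 1 then real ((M + j) choose (2 * M + 1 - j)) + real ((M + Suc j) choose (2 * M + 1 - j)) else 0))"
  proof -
    have j: "j \<le> 2 * n + 1"
      using assms by simp
    show ?thesis
      unfolding h1_series_shift_nth[OF j] sum.distrib[symmetric]
      by (intro sum.cong) (simp_all add: distrib_left)
  qed
  also have "\<dots> = (\<Sum>M\<le>n. (-1) ^ n / 2 * (3 * real j + 1) * boundary_term (Suc n) j M)"
  proof (intro sum.cong refl)
    fix M assume "M \<in> {..n}"
    then show "p_coeff n (n - M) 0 * (if j \<le> 2 * M + 1 then real ((M + j) choose (2 * M + 1 - j)) + real ((M + Suc j) choose (2 * M + 1 - j)) else 0) =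
       (-1) ^ n / 2 * (3 * real j + 1) * boundary_term (Suc n) j M"
      unfolding adjacent_binomials by (simp add: p_coeff_eq_weight boundary_term_def add.commute)
  qed
  also have "\<dots> = 0"
    unfolding sum_distrib_left[symmetric] boundary_sum_eq_0[OF assms] by simp
  finally show ?thesis .
qed

definition geometric_series :: "real fps" where "geometric_series = Abs_fps (\<lambda>_. 1)"

lemma one_plus_X_times_geometric: "(1 + fps_X) * geometric_series = 2 * geometric_series - 1"
  by (rule fps_ext) (simp add: geometric_series_def distrib_right fps_numeral_nth numeral_fps_const)

lemma mult_geometric_nth: "(f * geometric_series) $ m = (\<Sum>i\<le>m. f $ i)"
  by (simp add: geometric_series_def fps_mult_nth atLeast0AtMost)

lemma p_coeff_top: "p_coeff n n 0 = (-1) ^ n"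
  using p_coeff_eq_weight[of 0 n] by simp

lemma h1_series_2n: "h1_series n $ (2 * n) = (-1) ^ n"
proof -
  have "h1_series n $ (2 * n) = (\<Sum>M\<le>n. p_coeff n (n - M) 0 * real (M choose (2 * M)))"
    using h1_series_shift_nth[of 1 n 0] by simp
  also have "\<dots> = (\<Sum>M\<le>n. if M = 0 then p_coeff n (n - M) 0 else 0)"
    by (intro sum.cong) auto
  finally show ?thesis by (simp add: p_coeff_top)
qed

lemma h1_series_2n_1: "h1_series n $ (2 * n + 1) = 0"
  using h1_series_shift_nth[of 0 n 0] by (simp add: sum.neutral)

lemma binomial_row_sum: "(\<Sum>i\<le>m. real (N choose i)) = 2 ^ N" if "N \<le> m"
proof -
  have "(\<Sum>i\<le>m. real (N choose i)) = (\<Sum>i\<le>N. real (N choose i))"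
    using that by (intro sum.mono_neutral_right) auto
  also have "\<dots> = 2 ^ N"
    by (metis choose_row_sum of_nat_numeral of_nat_power of_nat_sum)
  finally show ?thesis .
qed

lemma h1_series_at_one:
  "(h1_series n * geometric_series) $ (2 * n + 1) = (if even n then 1 else 0)"
proof -
  have "(h1_series n * geometric_series) $ (2 * n + 1) =
    (\<Sum>k\<le>n. p_coeff n k 0 * ((fps_X ^ (2 * k) * ((1 + fps_X) ^ (n - k) * geometric_series)) $ (2 * n + 1)))"
    unfolding h1_series_def sum_distrib_right fps_sum_nth by (simp add: mult.assoc)
  also have "\<dots> = (\<Sum>k\<le>n. p_coeff n k 0 * 2 ^ (n - k))"
    by (intro sum.cong refl) (auto simp: fps_X_power_mult_nth mult_geometric_nth one_plus_X_power_nth binomial_row_sum)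
  finally show ?thesis by (simp add: p_coeff_power_sum)
qed

text \<open>
  The coefficient form of \<open>(1 + r) / (1 - r) = 2 / (1 - r) - 1\<close>.
\<close>
lemma partial_sum_recurrence:
  fixes f :: "real fps"
  shows "(f * (1 + fps_X) * geometric_series) $ m = 2 * (f * geometric_series) $ Suc m - 2 * f $ Suc m - f $ m"
proof -
  have "f * (1 + fps_X) * geometric_series = f * ((1 + fps_X) * geometric_series)" by (simp only: mult.assoc)
  also have "\<dots> = 2 * (f * geometric_series) - f"
    unfolding one_plus_X_times_geometric by (simp add: algebra_simps)
  finally show ?thesis
    by (simp only: mult_2 fps_add_nth fps_sub_nth mult_geometric_nth) simp
qed

lemma fps_mult_one_plus_X_nth: "(f * (1 + fps_X)) $ Suc m = (f $ Suc m + f $ m :: real)"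
  by (simp add: distrib_left)

text \<open>
  By the recurrence for partial sums, the value for \<open>j + 1\<close> is twice the value for \<open>j\<close> minus a sum of
  coefficients that cancels. The value for \<open>j = 1\<close> comes in the same way from \<open>H(1)\<close>, with
  the correction \<open>(-1)\<^sup>n\<close> from the leading coefficient of \<open>H\<close>.
\<close>
lemma h1_series_partial_sums:
  assumes "1 \<le> j" "j \<le> n + 1"
  shows "(h1_series n * (1 + fps_X) ^ j * geometric_series) $ (2 * n + 1 - j) = 2 ^ (j - 1)"
  using assms
proof (induction j rule: dec_induct)
  case base
  have "(h1_series n * (1 + fps_X) * geometric_series) $ (2 * n) = 1"
    using partial_sum_recurrence[of "h1_series n" "2 * n"]
      h1_series_at_one[of n] h1_series_2n[of n] h1_series_2n_1[of n]
    by simp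
  then show ?case by simp
next
  case (step j)
  let ?U = "h1_series n * (1 + fps_X) ^ j"
  obtain m where m: "2 * n + 1 - j = Suc m" "2 * n + 1 - Suc j = m"
    using step by (cases "2 * n + 1 - j") auto
  have U: "h1_series n * (1 + fps_X) ^ Suc j = ?U * (1 + fps_X)"
    by (simp add: mult_ac)
  have "?U $ Suc m + (?U * (1 + fps_X)) $ Suc m = 0"
    using h1_series_cancellation[of j n] step unfolding m U by simp
  then have "2 * ?U $ Suc m + ?U $ m = 0"
    unfolding fps_mult_one_plus_X_nth by simp
  moreover have "(?U * geometric_series) $ Suc m = 2 ^ (j - 1)"
    using step m by simp
  ultimately have "(?U * (1 + fps_X) * geometric_series) $ m = 2 * 2 ^ (j - 1)"
    using partial_sum_recurrence[of ?U m] by simp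
  then show ?case
    unfolding U m using step by (cases j) auto
qed

lemma h0_series_eq: "h0_series n = fps_X * (h1_series n * geometric_series) - Abs_fps (\<lambda>i. if even i then 1 else 0)"
proof (rule fps_ext)
  fix i
  show "h0_series n $ i = (fps_X * (h1_series n * geometric_series) - Abs_fps (\<lambda>i. if even i then 1 else 0)) $ i"
    by (cases i) (simp_all add: h0_series_def mult_geometric_nth lessThan_Suc_atMost)
qed

text \<open>
  One factor \<open>1 + r\<close> turns \<open>1 / (1 - r\<^sup>2)\<close> into the geometric series.
\<close>
lemma h0_series_times: "h0_series n * (1 + fps_X) ^ Suc j =
   fps_X * (h1_series n * (1 + fps_X) ^ Suc j * geometric_series) - (1 + fps_X) ^ j * geometric_series"
proof -
  define A :: "real fps" where "A = Abs_fps (\<lambda>i. if even i then 1 else 0)"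
  have A: "A * (1 + fps_X) = geometric_series"
  proof (rule fps_ext)
    fix i
    show "(A * (1 + fps_X)) $ i = geometric_series $ i"
      unfolding A_def geometric_series_def distrib_left by (cases i) simp_all
  qed
  have "(fps_X * (h1_series n * geometric_series) - A) * (1 + fps_X) ^ Suc j =
      fps_X * (h1_series n * (1 + fps_X) ^ Suc j * geometric_series) - (1 + fps_X) ^ j * (A * (1 + fps_X))"
    unfolding power_Suc by algebra
  then show ?thesis
    unfolding h0_series_eq A A_def[symmetric] .
qed

text \<open>
  Multiplied out, both parts of the series contribute \<open>2\<^sup>j\<^sup>-\<^sup>1\<close>: the first by the identity for \<open>H\<close>,
  the second since the partial sum is a full row sum of binomial coefficients.
\<close>
lemma h0_series_boundary:
  assumes "1 \<le> j" "j \<le> n + 1"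
  shows "(h0_series n * (1 + fps_X) ^ j) $ (2 * n + 2 - j) = 0"
proof -
  obtain i where i: "j = Suc i"
    using assms by (cases j) auto
  have e: "2 * n + 2 - j = Suc (2 * n + 1 - j)"
    using assms by auto
  have "((1 + fps_X) ^ i * geometric_series :: real fps) $ (2 * n + 2 - j) = 2 ^ i"
    unfolding mult_geometric_nth one_plus_X_power_nth using assms i by (intro binomial_row_sum) auto
  then show ?thesis
    using h1_series_partial_sums[OF assms]
    unfolding i h0_series_times by (simp only: e[unfolded i] fps_sub_nth fps_X_mult_nth) simp
qed

lemma h0_series_Suc_Suc:
  "h0_series n $ Suc (Suc i) = h0_series n $ i + h1_series n $ i + h1_series n $ Suc i"
  by (simp add: h0_series_def)

lemma h0_series_1: "h0_series n $ 1 = h1_series n $ 0"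
  by (simp add: h0_series_def)

text \<open>
  This is \<open>H(1)\<close> without its leading coefficient \<open>(-1)\<^sup>n\<close>, minus \<open>1\<close>.
\<close>
lemma h0_series_2n:
  assumes "1 \<le> n"
  shows "h0_series n $ (2 * n) = - (if even n then 1 else 0)"
proof -
  have "(\<Sum>i<2*n. h1_series n $ i) = (if even n then 1 else 0) - (-1) ^ n"
    using h1_series_at_one[of n] h1_series_2n[of n] h1_series_2n_1[of n]
    unfolding mult_geometric_nth by (simp add: lessThan_Suc_atMost[symmetric])
  then show ?thesis by (simp add: h0_series_def)
qed

section \<open>The entries of the column\<close>

text \<open>
  The entries at \<open>(i, i + 2j + 1)\<close> and \<open>(i, i + 2j)\<close> in terms of the generating series, where the equations of the
  linear system become multiplication by \<open>1 + r\<close>.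
\<close>
definition odd_entry :: "nat \<Rightarrow> nat \<Rightarrow> nat \<Rightarrow> real" where
  "odd_entry n i j = (-1) ^ j * (h1_series n * fps_binomial (- real j)) $ i"

definition even_entry :: "nat \<Rightarrow> nat \<Rightarrow> nat \<Rightarrow> real" where
  "even_entry n i j = (-1) ^ j * (h0_series n * (1 + fps_X) ^ j) $ (i + j)"

lemma odd_entry_0 [simp]: "odd_entry n i 0 = h1_series n $ i"
  by (simp add: odd_entry_def)

lemma even_entry_0 [simp]: "even_entry n i 0 = h0_series n $ i"
  by (simp add: even_entry_def)

lemma odd_entry_Suc:
  "odd_entry n i (Suc j) + (if i = 0 then 0 else odd_entry n (i - 1) (Suc j)) + odd_entry n i j = 0"
proof -
  let ?F = "h1_series n * fps_binomial (- real (Suc j))"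
  have "fps_binomial (- real j) = fps_binomial (- real (Suc j)) * (1 + fps_X)"
    by (simp flip: fps_binomial_1 fps_binomial_add_mult)
  then have e: "h1_series n * fps_binomial (- real j) = ?F * (1 + fps_X)"
    by (simp add: mult.assoc)
  show ?thesis
    unfolding odd_entry_def e by (cases i) (simp_all add: distrib_left)
qed

lemma even_entry_Suc:
  "even_entry n (i + 1) j + even_entry n i (Suc j) + even_entry n i j = 0"
proof -
  have e: "h0_series n * (1 + fps_X) ^ Suc j = h0_series n * (1 + fps_X) ^ j * (1 + fps_X)"
    by (simp only: power_Suc2 mult.assoc)
  show ?thesis
    unfolding even_entry_def e by (simp add: distrib_left)
qed

text \<open>
  The summand for \<open>k\<close> contributes the coefficient of index \<open>2N + 1\<close> of \<open>(1 + r)\<^sup>N\<close>, where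
  \<open>N = n - k - j\<close>. For \<open>N \<ge> 0\<close> the index exceeds the degree, and for \<open>N < 0\<close> it is negative.
\<close>
lemma odd_entry_top:
  assumes "i + 2 * j = 2 * n + 1"
  shows "odd_entry n i j = 0"
proof -
  have "(fps_X ^ (2 * k) * (1 + fps_X) ^ (n - k) * fps_binomial (- real j)) $ i = 0" if k: "k \<le> n" for k
  proof (cases "2 * k \<le> i")
    case True
    with assms have jk: "j + k \<le> n" by linarith
    have "i - 2 * k = 2 * (n - k - j) + 1"
      using assms jk by linarith
    have "(1 + fps_X) ^ (n - k) * fps_binomial (- real j) = fps_binomial (real (n - k) + - real j)"
      by (simp only: fps_binomial_of_nat fps_binomial_add_mult)
    also have "real (n - k) + - real j = real (n - k - j)"
      using jk by (simp add: of_nat_diff)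
    finally have "(1 + fps_X) ^ (n - k) * fps_binomial (- real j) = (1 + fps_X) ^ (n - k - j)"
      by (simp only: fps_binomial_of_nat)
    then show ?thesis
      using True \<open>i - 2 * k = 2 * (n - k - j) + 1\<close>
      by (simp add: mult.assoc fps_X_power_mult_nth one_plus_X_power_nth)
  next
    case False
    then show ?thesis by (simp add: mult.assoc fps_X_power_mult_nth)
  qed
  then have "(h1_series n * fps_binomial (- real j)) $ i = 0"
    unfolding h1_series_def sum_distrib_right fps_sum_nth
    by (intro sum.neutral) (simp add: mult.assoc)
  then show ?thesis by (simp add: odd_entry_def)
qed

lemma even_entry_top:
  assumes "i + 2 * j = 2 * n + 2" "1 \<le> j"
  shows "even_entry n i j = 0"
proof -
  have "i + j = 2 * n + 2 - j" "j \<le> n + 1" using assms by auto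
  then show ?thesis
    using h0_series_boundary[of j n] assms by (simp add: even_entry_def)
qed

lemma odd_entry_explicit:
  "odd_entry n i j = (\<Sum>l=0..i. (-1) ^ (j + l) * ((real j - 1 + real l) gchoose l) * h1_series n $ (i - l))"
proof -
  have "odd_entry n i j = (-1) ^ j * (fps_binomial (- real j) * h1_series n) $ i"
    by (simp add: odd_entry_def mult.commute)
  also have "\<dots> = (\<Sum>l=0..i. (-1) ^ (j + l) * ((real j - 1 + real l) gchoose l) * h1_series n $ (i - l))"
    unfolding fps_mult_nth sum_distrib_left fps_binomial_nth gbinomial_minus
    by (intro sum.cong) (simp_all add: power_add algebra_simps)
  finally show ?thesis .
qed

lemma even_entry_explicit:
  "even_entry n i j = (\<Sum>l=0..j. (-1) ^ j * real (j choose l) * h0_series n $ (i + l))"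
proof -
  have "((1 + fps_X) ^ j * h0_series n) $ (i + j) =
      (\<Sum>m=0..i+j. real (j choose m) * h0_series n $ (i + j - m))"
    by (simp add: fps_mult_nth one_plus_X_power_nth)
  also have "\<dots> = (\<Sum>m=0..j. real (j choose m) * h0_series n $ (i + j - m))"
    by (intro sum.mono_neutral_right) auto
  also have "\<dots> = (\<Sum>l=0..j. real (j choose l) * h0_series n $ (i + l))"
    by (rule sum.reindex_bij_witness[of _ "\<lambda>l. j - l" "\<lambda>m. j - m"])
      (auto simp: binomial_symmetric[symmetric])
  finally show ?thesis
    by (simp add: even_entry_def sum_distrib_left mult.commute mult.left_commute)
qed

section \<open>The linear system\<close>

text \<open>
  The value \<open>0\<close> outside the graph lets the equations refer to all neighbours in the lattice. On the
  line \<open>x\<^sub>1 = 2n\<close> the only odd vertex is \<open>b\<close> itself, for even \<open>n\<close>, and the diagonal entries of a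
  skew-symmetric inverse are \<open>0\<close>; the generic formula would give \<open>1\<close> there.
\<close>
definition inverse_column :: "nat \<Rightarrow> vertex \<Rightarrow> real" where
  "inverse_column n = (\<lambda>(x1, x2).
     if (x1, x2) \<notin> graph_V n then 0
     else if even (x1 + x2) then even_entry n (nat x1) (nat ((x2 - x1) div 2))
     else if x1 = 2 * int n then 0
     else odd_entry n (nat x1) (nat ((x2 - x1 - 1) div 2)))"

text \<open>
  The row of the Kasteleyn matrix at a vertex has entries only at the six lattice points listed in \<open>?B\<close>; the
  sum over the graph may be replaced by a sum over these because the vector vanishes outside.
\<close>
lemma kasteleyn_mult_vector:
  fixes f :: "vertex \<Rightarrow> complex"
  assumes "\<And>z. z \<notin> graph_V n \<Longrightarrow> f z = 0"
  shows "(\<Sum>z\<in>graph_V n. kasteleyn (a, b) z * f z) =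
    (if even (a + b)
     then f (a - 1, b) + f (a, b + 1) + f (a, b - 1) + (if a = b then f (a - 1, b - 1) - f (a + 1, b + 1) else 0)
     else - (f (a + 1, b) + f (a, b + 1) + f (a, b - 1)))"
proof -
  have half_eq: "kast_half (a, b) (c, d) = (if P then 1 else 0)"
    if "((a + b) mod 2 = 0 \<and> b = d \<and> a - c = 1) \<or> ((a + b) mod 2 = 0 \<and> \<bar>d - b\<bar> = 1 \<and> a = c)
       \<or> (a = b \<and> c = a - 1 \<and> d = a - 1) \<longleftrightarrow> P" for a b c d P
    unfolding kast_half.simps that ..
  let ?B = "{(a - 1, b), (a + 1, b), (a, b + 1), (a, b - 1), (a - 1, b - 1), (a + 1, b + 1)}"
  have "(\<Sum>z\<in>graph_V n. kasteleyn (a, b) z * f z) = (\<Sum>z\<in>graph_V n \<union> ?B. kasteleyn (a, b) z * f z)"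
    using assms by (intro sum.mono_neutral_left) (auto simp: finite_graph_V)
  also have "\<dots> = (\<Sum>z\<in>?B. kasteleyn (a, b) z * f z)"
  proof (intro sum.mono_neutral_right ballI)
    fix z assume "z \<in> graph_V n \<union> ?B - ?B"
    then have "z \<notin> ?B" by blast
    moreover obtain c d where z: "z = (c, d)"
      by (cases z)
    ultimately have ne: "\<not> (c = a - 1 \<and> d = b)" "\<not> (c = a + 1 \<and> d = b)" "\<not> (c = a \<and> d = b + 1)"
      "\<not> (c = a \<and> d = b - 1)" "\<not> (c = a - 1 \<and> d = b - 1)" "\<not> (c = a + 1 \<and> d = b + 1)"
      by auto
    have abs: "\<not> \<bar>d - b\<bar> = 1" "\<not> \<bar>b - d\<bar> = 1" if "a = c"
      using ne(3,4) that by linarith+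
    have diff: "\<not> a - c = 1" "\<not> c - a = 1" if "b = d"
      using ne(1,2) that by linarith+
    have diag: "\<not> (a = b \<and> c = a - 1 \<and> d = a - 1)" "\<not> (c = d \<and> a = c - 1 \<and> b = c - 1)"
      using ne(5,6) by fastforce+
    have "kast_half (a, b) z = 0"
      unfolding z kast_half.simps using abs diff diag by (intro if_not_P) blast
    moreover have "kast_half z (a, b) = 0"
      unfolding z kast_half.simps using abs diff diag by (intro if_not_P) blast
    ultimately show "kasteleyn (a, b) z * f z = 0"
      by (simp add: kasteleyn_def)
  qed (auto simp: finite_graph_V)
  also have "\<dots> = kasteleyn (a, b) (a - 1, b) * f (a - 1, b) + kasteleyn (a, b) (a + 1, b) * f (a + 1, b)
     + kasteleyn (a, b) (a, b + 1) * f (a, b + 1) + kasteleyn (a, b) (a, b - 1) * f (a, b - 1)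
     + kasteleyn (a, b) (a - 1, b - 1) * f (a - 1, b - 1) + kasteleyn (a, b) (a + 1, b + 1) * f (a + 1, b + 1)"
    by (simp add: add.assoc)
  also have "kasteleyn (a, b) (a - 1, b) = (if even (a + b) then 1 else 0)"
  proof -
    have "kast_half (a, b) (a - 1, b) = (if even (a + b) then 1 else 0)"
      by (rule half_eq) presburger
    moreover have "kast_half (a - 1, b) (a, b) = (if False then 1 else 0)"
      by (rule half_eq) presburger
    ultimately show ?thesis
      unfolding kasteleyn_def by (simp only:) simp
  qed
  also have "kasteleyn (a, b) (a + 1, b) = (if even (a + b) then 0 else -1)"
  proof -
    have "kast_half (a, b) (a + 1, b) = (if False then 1 else 0)"
      by (rule half_eq) presburger
    moreover have "kast_half (a + 1, b) (a, b) = (if odd (a + b) then 1 else 0)"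
      by (rule half_eq) presburger
    ultimately show ?thesis
      unfolding kasteleyn_def by (simp only:) simp
  qed
  also have "kasteleyn (a, b) (a, b + 1) = (if even (a + b) then 1 else -1)"
  proof -
    have "kast_half (a, b) (a, b + 1) = (if even (a + b) then 1 else 0)"
      by (rule half_eq) presburger
    moreover have "kast_half (a, b + 1) (a, b) = (if odd (a + b) then 1 else 0)"
      by (rule half_eq) presburger
    ultimately show ?thesis
      unfolding kasteleyn_def by (simp only:) simp
  qed
  also have "kasteleyn (a, b) (a, b - 1) = (if even (a + b) then 1 else -1)"
  proof -
    have "kast_half (a, b) (a, b - 1) = (if even (a + b) then 1 else 0)"
      by (rule half_eq) presburger
    moreover have "kast_half (a, b - 1) (a, b) = (if odd (a + b) then 1 else 0)"
      by (rule half_eq) presburger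
    ultimately show ?thesis
      unfolding kasteleyn_def by (simp only:) simp
  qed
  also have "kasteleyn (a, b) (a - 1, b - 1) = (if a = b then 1 else 0)"
  proof -
    have "kast_half (a, b) (a - 1, b - 1) = (if a = b then 1 else 0)"
      by (rule half_eq) presburger
    moreover have "kast_half (a - 1, b - 1) (a, b) = (if False then 1 else 0)"
      by (rule half_eq) presburger
    ultimately show ?thesis
      unfolding kasteleyn_def by (simp only:) simp
  qed
  also have "kasteleyn (a, b) (a + 1, b + 1) = (if a = b then -1 else 0)"
  proof -
    have "kast_half (a, b) (a + 1, b + 1) = (if False then 1 else 0)"
      by (rule half_eq) presburger
    moreover have "kast_half (a + 1, b + 1) (a, b) = (if a = b then 1 else 0)"
      by (rule half_eq) presburger
    ultimately show ?thesis
      unfolding kasteleyn_def by (simp only:) simp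
  qed
  finally show ?thesis
    by (cases "even (a + b)"; cases "a = b") simp_all
qed

lemma graph_V_iff: "(a, b) \<in> graph_V n \<longleftrightarrow>
   0 \<le> a \<and> a \<le> 2 * int n \<and> a \<le> b \<and> b \<le> 2 * int n + 1 \<and> \<not> (odd n \<and> a = 2 * int n \<and> b = 2 * int n + 1)"
  by (auto simp: graph_V_def)

lemma inverse_column_even:
  assumes "i + 2 * j \<le> 2 * n + 1" "i \<le> 2 * n"
  shows "inverse_column n (int i, int (i + 2 * j)) = even_entry n i j"
proof -
  have "(int i + int (i + 2 * j)) = 2 * (int i + int j)" by simp
  then have "even (int i + int (i + 2 * j))" by simp
  moreover have "(int i, int (i + 2 * j)) \<in> graph_V n"
    using assms unfolding graph_V_iff by presburger
  ultimately show ?thesis by (simp add: inverse_column_def)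
qed

lemma inverse_column_odd:
  assumes "i + 2 * j \<le> 2 * n" "i < 2 * n"
  shows "inverse_column n (int i, int (i + 2 * j + 1)) = odd_entry n i j"
proof -
  have "(int i + int (i + 2 * j + 1)) = 2 * (int i + int j) + 1" by simp
  then have "odd (int i + int (i + 2 * j + 1))" by simp
  moreover have "(int i, int (i + 2 * j + 1)) \<in> graph_V n"
    using assms unfolding graph_V_iff by presburger
  ultimately show ?thesis using assms by (simp add: inverse_column_def)
qed

lemma inverse_column_outside: "z \<notin> graph_V n \<Longrightarrow> inverse_column n z = 0"
  by (cases z) (simp add: inverse_column_def)

text \<open>
  If the upper neighbour \<open>(a, b + 1)\<close> is missing, its formal entry is \<open>0\<close> by \<open>even_entry_top\<close>, so the
  generic recurrence still applies. The line \<open>a = 2n\<close> has an odd vertex only for even \<open>n\<close>, namely \<open>b\<close>,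
  and produces the nonzero right-hand side.
\<close>
lemma inverse_column_odd_equation:
  assumes n: "1 \<le> n" and V: "(a, b) \<in> graph_V n" and odd: "odd (a + b)"
  shows "inverse_column n (a + 1, b) + inverse_column n (a, b + 1) + inverse_column n (a, b - 1) = (if (a, b) = vertex_b n then -1 else 0)"
proof -
  define i j where "i = nat a" and "j = nat ((b - a - 1) div 2)"
  have "0 \<le> a" "a \<le> b" using V unfolding graph_V_iff by auto
  moreover from this have "0 \<le> (b - a - 1) div 2" "b - a - 1 = 2 * ((b - a - 1) div 2)"
    using odd by presburger+
  ultimately have ai: "a = int i" and bj: "b = int i + 2 * int j + 1"
    unfolding i_def j_def by linarith+
  show ?thesis
  proof (cases "i = 2 * n")
    case True
    then have j: "j = 0" and e: "even n"
      using V unfolding graph_V_iff ai bj by auto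
    have "inverse_column n (int (2 * n), int (2 * n + 2 * 0)) = even_entry n (2 * n) 0"
      by (rule inverse_column_even) auto
    moreover have "inverse_column n (a + 1, b) = 0" "inverse_column n (a, b + 1) = 0"
      by (rule inverse_column_outside, simp add: graph_V_iff ai bj True)+
    moreover have "(a, b - 1) = (int (2 * n), int (2 * n + 2 * 0))"
      unfolding ai bj True j by simp
    moreover have "(a, b) = vertex_b n"
      using e unfolding ai bj True j vertex_b_def by simp
    ultimately show ?thesis
      using e by (simp only: even_entry_0 h0_series_2n[OF n]) simp
  next
    case False
    then have i: "i < 2 * n" and le: "i + 2 * j \<le> 2 * n"
      using V unfolding graph_V_iff ai bj by auto
    have e: "(a + 1, b) = (int (i + 1), int (i + 1 + 2 * j))" "(a, b - 1) = (int i, int (i + 2 * j))"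
      unfolding ai bj by auto
    have c: "inverse_column n (a + 1, b) = even_entry n (i + 1) j" "inverse_column n (a, b - 1) = even_entry n i j"
      unfolding e by (rule inverse_column_even; use i le in simp)+
    have "inverse_column n (a, b + 1) = even_entry n i (Suc j)"
    proof (cases "i + 2 * j = 2 * n")
      case True
      then have "(a, b + 1) \<notin> graph_V n"
        unfolding graph_V_iff ai bj by auto
      then show ?thesis
        using even_entry_top[of i "Suc j" n] True by (simp add: inverse_column_outside)
    next
      case False
      have e: "(a, b + 1) = (int i, int (i + 2 * Suc j))"
        unfolding ai bj by auto
      show ?thesis
        unfolding e by (rule inverse_column_even) (use False i le in auto)
    qed
    moreover have "(a, b) \<noteq> vertex_b n"
      using i unfolding vertex_b_def ai by auto
    ultimately show ?thesis
      using c even_entry_Suc[of n i j] by simp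
  qed
qed

text \<open>
  Off the diagonal, a missing upper neighbour has formal entry \<open>0\<close> by \<open>odd_entry_top\<close>, and the
  recurrence for the odd entries applies. On the diagonal, the equation is the recurrence of the
  coefficients of \<open>h0_series\<close>, except in the corner \<open>(2n, 2n)\<close>, where it evaluates to \<open>h\<^sup>0(2n) + 1\<close>; this
  is \<open>1\<close> exactly if \<open>n\<close> is odd, that is if the corner is \<open>b\<close>.
\<close>
lemma inverse_column_even_equation:
  assumes n: "1 \<le> n" and V: "(a, b) \<in> graph_V n" and even: "even (a + b)"
  shows "inverse_column n (a - 1, b) + inverse_column n (a, b + 1) + inverse_column n (a, b - 1) +
      (if a = b then inverse_column n (a - 1, b - 1) - inverse_column n (a + 1, b + 1) else 0)
     = (if (a, b) = vertex_b n then 1 else 0)"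
proof -
  define i j where "i = nat a" and "j = nat ((b - a) div 2)"
  have "0 \<le> a" "a \<le> b" using V unfolding graph_V_iff by auto
  moreover from this have "0 \<le> (b - a) div 2" "b - a = 2 * ((b - a) div 2)"
    using even by presburger+
  ultimately have ai: "a = int i" and bj: "b = int i + 2 * int j"
    unfolding i_def j_def by linarith+
  have le: "i + 2 * j \<le> 2 * n + 1" "i \<le> 2 * n"
    using V unfolding graph_V_iff ai bj by auto
  have left: "inverse_column n (a - 1, b) = (if i = 0 then 0 else odd_entry n (i - 1) j)"
  proof (cases i)
    case 0
    then have "(a - 1, b) \<notin> graph_V n"
      unfolding graph_V_iff ai by auto
    then show ?thesis using 0 by (simp add: inverse_column_outside)
  next
    case (Suc k)
    then have e: "(a - 1, b) = (int k, int (k + 2 * j + 1))"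
      unfolding ai bj by auto
    have "inverse_column n (a - 1, b) = odd_entry n k j"
      unfolding e by (rule inverse_column_odd) (use le Suc in auto)
    then show ?thesis using Suc by simp
  qed
  have up: "inverse_column n (a, b + 1) = odd_entry n i j" if "i < 2 * n"
  proof (cases "i + 2 * j = 2 * n + 1")
    case True
    then have "(a, b + 1) \<notin> graph_V n"
      unfolding graph_V_iff ai bj by auto
    then show ?thesis
      using odd_entry_top[OF True] by (simp add: inverse_column_outside)
  next
    case False
    have e: "(a, b + 1) = (int i, int (i + 2 * j + 1))"
      unfolding ai bj by auto
    show ?thesis
      unfolding e by (rule inverse_column_odd) (use False that le in auto)
  qed
  show ?thesis
  proof (cases j)
    case (Suc k)
    then have i: "i < 2 * n" using le by auto
    have e: "(a, b - 1) = (int i, int (i + 2 * k + 1))"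
      unfolding ai bj Suc by auto
    have "inverse_column n (a, b - 1) = odd_entry n i k"
      unfolding e by (rule inverse_column_odd) (use le i Suc in auto)
    moreover have "(a, b) \<noteq> vertex_b n" "a \<noteq> b"
      using i Suc unfolding vertex_b_def ai bj by auto
    ultimately show ?thesis
      using left up[OF i] odd_entry_Suc[of n i k] unfolding Suc by (simp add: add_ac)
  next
    case 0
    have ab: "b = a" unfolding ai bj 0 by simp
    have "(a, b - 1) \<notin> graph_V n"
      unfolding graph_V_iff ab by simp
    then have down: "inverse_column n (a, b - 1) = 0"
      by (rule inverse_column_outside)
    have diag_left: "inverse_column n (a - 1, b - 1) = (if i = 0 then 0 else h0_series n $ (i - 1))"
    proof (cases i)
      case 0
      then have "(a - 1, b - 1) \<notin> graph_V n"
        unfolding graph_V_iff ai by auto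
      then show ?thesis using 0 by (simp add: inverse_column_outside)
    next
      case (Suc k)
      then have e: "(a - 1, b - 1) = (int k, int (k + 2 * 0))"
        unfolding ab ai by auto
      have "inverse_column n (a - 1, b - 1) = even_entry n k 0"
        unfolding e by (rule inverse_column_even) (use le Suc in auto)
      then show ?thesis using Suc by simp
    qed
    show ?thesis
    proof (cases "i = 2 * n")
      case False
      then have i: "i < 2 * n" using le by simp
      have e: "(a + 1, b + 1) = (int (i + 1), int (i + 1 + 2 * 0))"
        unfolding ab ai by auto
      have "inverse_column n (a + 1, b + 1) = even_entry n (i + 1) 0"
        unfolding e by (rule inverse_column_even) (use i in auto)
      then have "inverse_column n (a + 1, b + 1) = h0_series n $ (i + 1)"
        by simp
      moreover have "(a, b) \<noteq> vertex_b n"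
        using i unfolding vertex_b_def ai by auto
      moreover have "h0_series n $ (i + 1) = h1_series n $ i +
          (if i = 0 then 0 else h1_series n $ (i - 1) + h0_series n $ (i - 1))"
        using h0_series_1[of n] h0_series_Suc_Suc[of n "i - 1"] by (cases i) auto
      ultimately show ?thesis
        using left up[OF i] down diag_left 0 ab by simp
    next
      case True
      have "(a + 1, b + 1) \<notin> graph_V n"
        unfolding graph_V_iff ab ai True by simp
      then have "inverse_column n (a + 1, b + 1) = 0"
        by (rule inverse_column_outside)
      moreover have "inverse_column n (a, b + 1) = 0"
        using even unfolding inverse_column_def ab ai True by simp
      moreover have "(a, b) = vertex_b n \<longleftrightarrow> odd n"
        unfolding vertex_b_def ab ai True by (simp, presburger)
      moreover have "h0_series n $ (2 * n) = h0_series n $ (2 * n - 1) + h1_series n $ (2 * n - 1) - 1"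
      proof -
        define m where "m = 2 * n - 1"
        then have m: "2 * n = Suc m" "odd m" using n by simp_all
        show ?thesis unfolding m(1) h0_series_def using m by simp
      qed
      ultimately show ?thesis
        using left down diag_left 0 ab n h0_series_2n[OF n] True by auto
    qed
  qed
qed

lemma inverse_column_solves:
  assumes n: "1 \<le> n" and V: "x \<in> graph_V n"
  shows "(\<Sum>z\<in>graph_V n. kasteleyn x z * of_real (inverse_column n z)) = (if x = vertex_b n then 1 else 0)"
proof -
  obtain a b where x: "x = (a, b)" by (cases x)
  have v: "(\<Sum>z\<in>graph_V n. kasteleyn (a, b) z * of_real (inverse_column n z)) = complex_of_real
    (if even (a + b)
     then inverse_column n (a - 1, b) + inverse_column n (a, b + 1) + inverse_column n (a, b - 1) +
       (if a = b then inverse_column n (a - 1, b - 1) - inverse_column n (a + 1, b + 1) else 0)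
     else - (inverse_column n (a + 1, b) + inverse_column n (a, b + 1) + inverse_column n (a, b - 1)))"
    by (subst kasteleyn_mult_vector) (auto simp: inverse_column_outside)
  show ?thesis
    unfolding x v
    using inverse_column_odd_equation[OF n V[unfolded x]] inverse_column_even_equation[OF n V[unfolded x]]
    by (cases "even (a + b)") simp_all
qed

text \<open>Applying the left inverse \<open>B\<close> to \<open>A f = e\<^sub>b\<close> gives \<open>f = B e\<^sub>b\<close>.\<close>
lemma inverse_entry:
  assumes inv: "inverse_matrix_on V A B" and "finite V" "x \<in> V" "b \<in> V"
    and f: "\<And>y. y \<in> V \<Longrightarrow> (\<Sum>z\<in>V. A y z * f z) = (if y = b then 1 else 0)"
  shows "B x b = f x"
proof -
  have "B x b = (\<Sum>y\<in>V. B x y * (\<Sum>z\<in>V. A y z * f z))"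
    using assms by (simp add: f if_distrib sum.delta cong: if_cong)
  also have "\<dots> = (\<Sum>z\<in>V. (\<Sum>y\<in>V. B x y * A y z) * f z)"
    unfolding sum_distrib_left sum_distrib_right mult.assoc by (rule sum.swap)
  also have "\<dots> = (\<Sum>z\<in>V. (if x = z then 1 else 0) * f z)"
    using inv \<open>x \<in> V\<close> unfolding inverse_matrix_on_def by (intro sum.cong) auto
  also have "\<dots> = f x"
    using assms by (simp add: if_distrib[of "\<lambda>c. c * _"] sum.delta cong: if_cong)
  finally show ?thesis .
qed

lemma vertex_b_in_graph: "vertex_b n \<in> graph_V n"
  unfolding vertex_b_def graph_V_iff by presburger

lemma of_real_gchoose: "complex_of_real (a gchoose l) = of_real a gchoose l"
  by (simp add: gbinomial_prod_rev)

theorem theorem3p1: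
  fixes n :: nat and \<rho> :: real and Kinv :: "vertex \<Rightarrow> vertex \<Rightarrow> complex"
  assumes "n \<ge> 1"
    and "0 < \<rho>" and "\<rho> < 1"
    and "inverse_matrix_on (graph_V n) kasteleyn Kinv"
  shows "(\<forall>i1 i2 :: nat. i1 \<le> 2 * n - 1 \<and> int i2 \<le> int n - \<lceil>real i1 / 2\<rceil> \<longrightarrow>
            Kinv (int i1, int i1 + 2 * int i2 + 1) (vertex_b n) =
              (\<Sum>l = 0..i1. (-1) ^ (i2 + l) * ((of_nat i2 - 1 + of_nat l) gchoose l) * h1b \<rho> n (i1 - l)))
       \<and> (\<forall>i1 i2 :: nat. i1 \<le> 2 * n - 1 \<and> int i2 \<le> int n - \<lfloor>real i1 / 2\<rfloor> \<longrightarrow>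
            Kinv (int i1, int i1 + 2 * int i2) (vertex_b n) =
              (\<Sum>l = 0..i2. (-1) ^ i2 * of_nat (i2 choose l) * h0b \<rho> n (i1 + l)))
       \<and> (even n \<longrightarrow> Kinv (2 * int n, 2 * int n) (vertex_b n) = -1)"
proof -
  have entry: "Kinv x (vertex_b n) = of_real (inverse_column n x)" if "x \<in> graph_V n" for x
    using assms that by (intro inverse_entry[OF assms(4)]) (auto simp: finite_graph_V vertex_b_in_graph inverse_column_solves)
  have 1: "Kinv (int i1, int i1 + 2 * int i2 + 1) (vertex_b n) =
      (\<Sum>l = 0..i1. (-1) ^ (i2 + l) * ((of_nat i2 - 1 + of_nat l) gchoose l) * h1b \<rho> n (i1 - l))"
    if "i1 \<le> 2 * n - 1" "int i2 \<le> int n - \<lceil>real i1 / 2\<rceil>" for i1 i2 :: nat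
  proof -
    have "real i1 / 2 \<le> real_of_int \<lceil>real i1 / 2\<rceil>" by simp
    then have le: "i1 + 2 * i2 \<le> 2 * n" "i1 < 2 * n"
      using that assms(1) by linarith+
    then have V: "(int i1, int i1 + 2 * int i2 + 1) \<in> graph_V n"
      unfolding graph_V_iff by presburger
    have "inverse_column n (int i1, int i1 + 2 * int i2 + 1) = odd_entry n i1 i2"
      using inverse_column_odd[OF le] by (simp add: algebra_simps)
    then show ?thesis
      unfolding entry[OF V] odd_entry_explicit h1b_eq[OF assms(2)] by (simp add: of_real_gchoose)
  qed
  have 2: "Kinv (int i1, int i1 + 2 * int i2) (vertex_b n) =
      (\<Sum>l = 0..i2. (-1) ^ i2 * of_nat (i2 choose l) * h0b \<rho> n (i1 + l))"
    if "i1 \<le> 2 * n - 1" "int i2 \<le> int n - \<lfloor>real i1 / 2\<rfloor>" for i1 i2 :: nat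
  proof -
    have "\<lfloor>real i1 / 2\<rfloor> = int (i1 div 2)"
      using floor_divide_of_nat_eq[of i1 2] by simp
    then have le: "i1 + 2 * i2 \<le> 2 * n + 1" "i1 < 2 * n"
      using that assms(1) by linarith+
    then have V: "(int i1, int i1 + 2 * int i2) \<in> graph_V n"
      unfolding graph_V_iff by presburger
    have "inverse_column n (int i1, int i1 + 2 * int i2) = even_entry n i1 i2"
      using inverse_column_even[of i1 i2 n] le by simp
    then show ?thesis
      unfolding entry[OF V] even_entry_explicit h0b_eq[OF assms(2,3)] by simp
  qed
  have 3: "Kinv (2 * int n, 2 * int n) (vertex_b n) = -1" if "even n"
  proof -
    have "(2 * int n, 2 * int n) \<in> graph_V n"
      unfolding graph_V_iff by simp
    moreover have "inverse_column n (2 * int n, 2 * int n) = h0_series n $ (2 * n)"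
      using inverse_column_even[of "2 * n" 0 n] by simp
    ultimately show ?thesis
      using h0_series_2n[OF assms(1)] that by (simp add: entry)
  qed
  show ?thesis using 1 2 3 by blast
qed

end
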